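(* Let $0<t<\frac13$ and let $\mathcal C_u\subset F^{\mathbb R}$ be the set defined in the context. Then $\mathcal C_u$ is a connected component which consists of unitarizable representations only.
   Context: Let $S=\mathbb{CP}^1\setminus\{0,1,\infty\}$ and $\zeta=e^{2\pi i/3}$. Consider representations of $\pi_1(S)$ into $\mathrm{SL}_3(\mathbb{C})$, i.e. triples $M_0,M_1,M_\infty\in\mathrm{SL}_3(\mathbb{C})$ with $M_\infty M_1M_0=\mathrm{Id}$, such that $M_1$ is conjugate to $\mathrm{diag}(1,e^{2\pi it},e^{-2\pi it})$ and $M_0,M_\infty$ are conjugate to $\mathrm{diag}(\zeta,1,\zeta^{-1})$. Trace coordinates: $X=\mathrm{tr}(M_1M_0^{-1})$, $Y=\mathrm{tr}(M_1^{-1}M_0)$, $Z=\mathrm{tr}(M_1M_0M_1^{-1}M_0^{-1})$. They satisfy $P(X,Y,Z)=0$ with $$P=2(2\cos 2\pi t+\cos4\pi t)(XY-Z)+4\cos6\pi t+X^3-XY(Z+3)+Y^3+Z^2+5,$$ and $F=\{(X,Y,Z)\in\mathbb{C}^3\mid P=0\}$ is naturally identified with the relative character variety. Every point of $F$ is realized by such a representation; such a representation is reducible iff $(X,Y,Z)$ is one of the three singular points of $F$, namely those with $Z=-2\cos2\pi t+2\cos4\pi t+3$ and $(X,Y)=4\sin^2(\pi t)\,(\zeta^{j},\zeta^{-j})$, $j=0,1,2$. $F^*$ denotes $F$ with these three points removed; two irreducible representations are conjugate iff their trace coordinates agree, and points of $F^*$ are not distinguished from conjugacy classes of irreducible representations.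 For $(X,Y,Z)\in F$ let $\tilde Z$ be the second root of the quadratic polynomial $P(X,Y,\cdot)$, and set $F^{\mathbb R}=\{(X,Y,Z)\in F\mid\bar X=Y,\ \bar Z=\tilde Z\}$. A representation is unitarizable if it is conjugate in $\mathrm{SL}_3(\mathbb C)$ to a representation into $\mathrm{SU}_3$. For real $A$ put $H=\sqrt{(-\cos2\pi t+A+1)^2(4\cos2\pi t+2A+5)}$, $E=4\cos2\pi t+2\cos4\pi t-A^2-12A-6$, $B_1=\sqrt{E-4H}$, $B_2=\sqrt{E+4H}$, $B_3=-B_1$, $B_4=-B_2$. Then $\mathcal C_u$ is the set of all $(A+iB,A-iB,Z)\in F$ with $(A,B)\in\mathbb{R}^2$ satisfying one of: (1) $\cos2\pi t-1\le A\le-8\sin^2(\frac{\pi t}2)\cos\pi t$ and $B_1\le B\le B_2$; (2) $\cos2\pi t-1\le A\le-8\sin^2(\frac{\pi t}2)\cos\pi t$ and $B_4\le B\le B_3$; (3) $-8\sin^2(\frac{\pi t}2)\cos\pi t\le A\le4\sin^2\pi t$ and $B_4\le B\le B_2$. Background on the word "component": $F^{\mathbb R}\cap F^*$ has four connected components; their closures are obtained by adding singular points of $F$, and $\mathcal C_u$ is one of these four closed connected sets. Different ones among the four sets intersect only in singular points of $F$. *)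

theory Defs
  imports "HOL-Analysis.Analysis"
begin

type_synonym cmat3 = "complex^3^3"

definition zeta3 :: complex where
  "zeta3 = exp (2 * of_real pi * \<i> / 3)"

definition diag3 :: "complex \<Rightarrow> complex \<Rightarrow> complex \<Rightarrow> cmat3" where
  "diag3 a b c = vector [vector [a, 0, 0], vector [0, b, 0], vector [0, 0, c]]"

definition SL3 :: "cmat3 set" where
  "SL3 = {A. det A = 1}"

definition conj_transpose :: "cmat3 \<Rightarrow> cmat3" where
  "conj_transpose A = (\<chi> i j. cnj (A $ j $ i))"

definition SU3 :: "cmat3 set" where
  "SU3 = {A \<in> SL3. conj_transpose A ** A = mat 1}"

definition conj_by :: "cmat3 \<Rightarrow> cmat3 \<Rightarrow> cmat3" where
  "conj_by g A = g ** A ** matrix_inv g"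

definition SL3_conjugate :: "cmat3 \<Rightarrow> cmat3 \<Rightarrow> bool" where
  "SL3_conjugate A B \<longleftrightarrow> (\<exists>g \<in> SL3. conj_by g A = B)"

text \<open>
  A representation of the fundamental group of the three-punctured sphere is a triple
  \<open>(M0, M1, Minf)\<close> of images of the loops around \<open>0, 1, \<infinity>\<close>, subject to
  \<open>Minf M1 M0 = Id\<close>; here the local conjugacy classes are prescribed as well.
\<close>

definition is_rep :: "real \<Rightarrow> cmat3 \<times> cmat3 \<times> cmat3 \<Rightarrow> bool" where
  "is_rep t = (\<lambda>(M0, M1, Minf).
     M0 \<in> SL3 \<and> M1 \<in> SL3 \<and> Minf \<in> SL3 \<and>
     Minf ** M1 ** M0 = mat 1 \<and>
     SL3_conjugate M1 (diag3 1 (exp (2 * of_real pi * \<i> * of_real t))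
                               (exp (- 2 * of_real pi * \<i> * of_real t))) \<and>
     SL3_conjugate M0 (diag3 zeta3 1 (inverse zeta3)) \<and>
     SL3_conjugate Minf (diag3 zeta3 1 (inverse zeta3)))"

definition trace_coords :: "cmat3 \<times> cmat3 \<times> cmat3 \<Rightarrow> complex \<times> complex \<times> complex" where
  "trace_coords = (\<lambda>(M0, M1, Minf).
     (trace (M1 ** matrix_inv M0),
      trace (matrix_inv M1 ** M0),
      trace (M1 ** M0 ** matrix_inv M1 ** matrix_inv M0)))"

definition unitarizable :: "cmat3 \<times> cmat3 \<times> cmat3 \<Rightarrow> bool" where
  "unitarizable = (\<lambda>(M0, M1, Minf).
     \<exists>g \<in> SL3. conj_by g M0 \<in> SU3 \<and> conj_by g M1 \<in> SU3 \<and> conj_by g Minf \<in> SU3)"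

definition P :: "real \<Rightarrow> complex \<Rightarrow> complex \<Rightarrow> complex \<Rightarrow> complex" where
  "P t X Y Z =
     2 * of_real (2 * cos (2 * pi * t) + cos (4 * pi * t)) * (X * Y - Z)
     + 4 * of_real (cos (6 * pi * t))
     + X ^ 3 - X * Y * (Z + 3) + Y ^ 3 + Z ^ 2 + 5"

definition F :: "real \<Rightarrow> (complex \<times> complex \<times> complex) set" where
  "F t = {(X, Y, Z). P t X Y Z = 0}"

definition F_sing :: "real \<Rightarrow> (complex \<times> complex \<times> complex) set" where
  "F_sing t =
     {(of_real (4 * (sin (pi * t))\<^sup>2) * zeta3 ^ j,
       of_real (4 * (sin (pi * t))\<^sup>2) * inverse zeta3 ^ j,
       of_real (- 2 * cos (2 * pi * t) + 2 * cos (4 * pi * t) + 3)) | j. j \<in> {0, 1, 2 :: nat}}"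

definition F_star :: "real \<Rightarrow> (complex \<times> complex \<times> complex) set" where
  "F_star t = F t - F_sing t"

text \<open>
  \<open>P t X Y\<close> is monic of degree two in its last argument, so for a root \<open>Z\<close> the factorization
  below determines the other root (which equals \<open>Z\<close> if the root is double).
\<close>

definition second_root :: "real \<Rightarrow> complex \<Rightarrow> complex \<Rightarrow> complex \<Rightarrow> complex" where
  "second_root t X Y Z = (THE Z'. \<forall>w. P t X Y w = (w - Z) * (w - Z'))"

definition F_real :: "real \<Rightarrow> (complex \<times> complex \<times> complex) set" where
  "F_real t = {(X, Y, Z). (X, Y, Z) \<in> F t \<and> cnj X = Y \<and> cnj Z = second_root t X Y Z}"

text \<open>
  The components of \<open>F_real t\<close> are understood as the closures of the connected components of its
  part away from the singular points; distinct ones may share singular points.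
\<close>

definition closed_components :: "real \<Rightarrow> (complex \<times> complex \<times> complex) set set" where
  "closed_components t = closure ` components (F_real t \<inter> F_star t)"

text \<open>
  For \<open>0 < t < 1/3\<close> the arguments of all square roots below are nonnegative in the ranges of
  \<open>A\<close> in which \<open>C_u\<close> uses them, so the values of \<open>sqrt\<close> at negative reals play no role.
\<close>

definition H :: "real \<Rightarrow> real \<Rightarrow> real" where
  "H t A = sqrt ((- cos (2 * pi * t) + A + 1)\<^sup>2 * (4 * cos (2 * pi * t) + 2 * A + 5))"

definition E :: "real \<Rightarrow> real \<Rightarrow> real" where
  "E t A = 4 * cos (2 * pi * t) + 2 * cos (4 * pi * t) - A\<^sup>2 - 12 * A - 6"

definition B1 :: "real \<Rightarrow> real \<Rightarrow> real" where "B1 t A = sqrt (E t A - 4 * H t A)"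
definition B2 :: "real \<Rightarrow> real \<Rightarrow> real" where "B2 t A = sqrt (E t A + 4 * H t A)"
definition B3 :: "real \<Rightarrow> real \<Rightarrow> real" where "B3 t A = - B1 t A"
definition B4 :: "real \<Rightarrow> real \<Rightarrow> real" where "B4 t A = - B2 t A"

definition A_mid :: "real \<Rightarrow> real" where
  "A_mid t = - 8 * (sin (pi * t / 2))\<^sup>2 * cos (pi * t)"

definition C_u :: "real \<Rightarrow> (complex \<times> complex \<times> complex) set" where
  "C_u t = {(X, Y, Z). (X, Y, Z) \<in> F t \<and>
     (\<exists>A B :: real. X = of_real A + \<i> * of_real B \<and> Y = of_real A - \<i> * of_real B \<and>
       (cos (2 * pi * t) - 1 \<le> A \<and> A \<le> A_mid t \<and> B1 t A \<le> B \<and> B \<le> B2 t A \<or>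
        cos (2 * pi * t) - 1 \<le> A \<and> A \<le> A_mid t \<and> B4 t A \<le> B \<and> B \<le> B3 t A \<or>
        A_mid t \<le> A \<and> A \<le> 4 * (sin (pi * t))\<^sup>2 \<and> B4 t A \<le> B \<and> B \<le> B2 t A))}"

end

theory Submission
  imports Defs
begin

text \<open>
  Write \<open>\<tau> = 1 + 2 cos 2\<pi>t\<close> and \<open>X = A + iB\<close>. On \<open>Y = cnj X\<close> the polynomial \<open>P t X Y\<close> has real
  coefficients, so the condition \<open>cnj Z = second_root t X Y Z\<close> says that its discriminant \<open>disc\<close> is at
  most \<open>0\<close>. The singular points are nodes of the quartic curve \<open>disc = 0\<close>; the line
  \<open>A = cos 2\<pi>t - 1\<close> joins two of them and meets the curve nowhere else, and on \<open>A = 3 - \<tau>\<close> the only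
  point with \<open>disc \<le> 0\<close> is the third one. Hence \<open>C_u\<close> is the part of \<open>F_real\<close> in the strip between
  these lines and, without the nodes, it is open and closed in \<open>F_real \<inter> F_star\<close>. It is connected as a
  double cover of a curvilinear triangle branched along the boundary.

  For unitarity, diagonalize \<open>M0\<close>. Then \<open>X\<close> determines the diagonal of \<open>m = M1\<close>, the diagonal of
  \<open>n = matrix_inv m\<close> is the conjugate one, and \<open>r i j = n i j * m j i\<close> are the entries of a real matrix
  with row and column sums \<open>1\<close> which \<open>(X, Z)\<close> determines. If all \<open>r i j\<close> are nonnegative, a matrix of
  determinant \<open>1\<close> with this diagonal and with \<open>\<bar>m j i\<bar>\<^sup>2 = r i j\<close> has unit rows, hence is unitary by the
  equality case of Hadamard's inequality; such a matrix can be built by choosing phases, and if all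
  \<open>r i j + r j i\<close> are positive, \<open>m\<close> can be brought to this form by a diagonal conjugation. Since
  \<open>r i j * r j i\<close> is a squared modulus, the signs are governed by \<open>r i j + r j i\<close>, which is positive at
  \<open>X = 0\<close> and vanishes on \<open>disc \<le> 0\<close> only at nodes; so it is positive throughout \<open>C_u \<inter> F_star\<close>.
\<close>

subsection \<open>The real points of the cubic surface\<close>

text \<open>The common trace of \<open>M1\<close> and its inverse, the sum of the eigenvalues 1,
  exp(2 pi i t) and exp(-2 pi i t). The coefficients of \<open>P\<close> are polynomials in
  it.\<close>

definition tau :: "real \<Rightarrow> real" where
  "tau t = 1 + 2 * cos (2 * pi * t)"

text \<open>Discriminant in Z of the monic quadratic \<open>P t X Y\<close> for X = A + iB and Y = A
  - iB; the term X^3 + Y^3 has become 2 A^3 - 6 A B^2.\<close>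

definition disc :: "real \<Rightarrow> real \<Rightarrow> real \<Rightarrow> real" where
  "disc \<tau> A B = (A\<^sup>2 + B\<^sup>2 + \<tau>\<^sup>2 - 3)\<^sup>2
     - 4 * (2 * A ^ 3 - 6 * A * B\<^sup>2 + (\<tau>\<^sup>2 - 6) * (A\<^sup>2 + B\<^sup>2) + 2 * \<tau> ^ 3 - 6 * \<tau>\<^sup>2 + 9)"

section \<open>Trigonometric constants in terms of tau\<close>

lemma cos_2pi: "cos (2 * pi * t) = (tau t - 1) / 2"
  by (simp add: tau_def)

lemma cos_4pi: "cos (4 * pi * t) = (tau t - 1)\<^sup>2 / 2 - 1"
proof -
  have "cos (4 * pi * t) = cos (2 * (2 * pi * t))" by (simp add: algebra_simps)
  also have "\<dots> = 2 * (cos (2 * pi * t))\<^sup>2 - 1" by (rule cos_double_cos)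
  finally show ?thesis unfolding cos_2pi by (simp add: power2_eq_square)
qed

lemma cos_6pi: "cos (6 * pi * t) = (tau t - 1) ^ 3 / 2 - 3 * (tau t - 1) / 2"
proof -
  have "cos (6 * pi * t) = cos (3 * (2 * pi * t))" by (simp add: algebra_simps)
  also have "\<dots> = 4 * cos (2 * pi * t) ^ 3 - 3 * cos (2 * pi * t)" by (rule cos_treble_cos)
  finally show ?thesis unfolding cos_2pi by (simp add: power3_eq_cube)
qed

lemma tau_cos_pi: "tau t = 4 * (cos (pi * t))\<^sup>2 - 1"
proof -
  have "cos (2 * pi * t) = cos (2 * (pi * t))" by (simp add: algebra_simps)
  also have "\<dots> = 2 * (cos (pi * t))\<^sup>2 - 1" by (rule cos_double_cos)
  finally show ?thesis by (simp add: tau_def)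
qed

lemma sin_pi_sq: "4 * (sin (pi * t))\<^sup>2 = 3 - tau t"
  by (simp add: tau_cos_pi sin_squared_eq)

lemma A_mid_eq: "A_mid t = 4 * (cos (pi * t))\<^sup>2 - 4 * cos (pi * t)"
proof -
  have "cos (pi * t) = cos (2 * (pi * t / 2))" by simp
  also have "\<dots> = 1 - 2 * (sin (pi * t / 2))\<^sup>2" by (rule cos_double_sin)
  finally have s: "2 * (sin (pi * t / 2))\<^sup>2 = 1 - cos (pi * t)" by simp
  have "A_mid t = - 4 * (2 * (sin (pi * t / 2))\<^sup>2) * cos (pi * t)" by (simp add: A_mid_def)
  then show ?thesis unfolding s by (simp add: algebra_simps power2_eq_square)
qed

lemma cos_pi_bounds:
  assumes "0 < t" "t < 1 / 3"
  shows "1 / 2 < cos (pi * t)" "cos (pi * t) < 1"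
proof -
  have "pi * t < pi / 3" using assms by simp
  then have "cos (pi / 3) < cos (pi * t)"
    using assms by (intro cos_monotone_0_pi) auto
  then show "1 / 2 < cos (pi * t)" by (simp add: cos_60)
  have "cos (pi * t) < cos 0"
    using assms \<open>pi * t < pi / 3\<close> by (intro cos_monotone_0_pi) (auto simp: field_simps)
  then show "cos (pi * t) < 1" by simp
qed

lemma tau_bounds:
  assumes "0 < t" "t < 1 / 3"
  shows "0 < tau t" "tau t < 3"
proof -
  note k = cos_pi_bounds[OF assms]
  have "(1/2) * (1/2) < cos (pi * t) * cos (pi * t)" using k by (intro mult_strict_mono) auto
  moreover have "cos (pi * t) * cos (pi * t) < 1 * 1" using k by (intro mult_strict_mono) auto
  ultimately show "0 < tau t" "tau t < 3" by (auto simp: tau_cos_pi power2_eq_square)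
qed

section \<open>The quadratic equation for Z and its real structure\<close>

lemma P_eq:
  "P t X Y Z = Z\<^sup>2 - (X * Y + of_real ((tau t)\<^sup>2 - 3)) * Z
     + (X ^ 3 + Y ^ 3 + of_real ((tau t)\<^sup>2 - 6) * (X * Y)
        + of_real (2 * tau t ^ 3 - 6 * (tau t)\<^sup>2 + 9))"
  unfolding P_def cos_2pi cos_4pi cos_6pi
  by (simp add: field_simps power2_eq_square power3_eq_cube)

lemma second_root_eq:
  assumes "P t X Y Z = 0"
  shows "second_root t X Y Z = X * Y + of_real ((tau t)\<^sup>2 - 3) - Z"
  unfolding second_root_def
proof (rule the_equality)
  show "\<forall>w. P t X Y w = (w - Z) * (w - (X * Y + of_real ((tau t)\<^sup>2 - 3) - Z))"
  proof
    fix w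
    have "P t X Y w - P t X Y Z = (w - Z) * (w - (X * Y + of_real ((tau t)\<^sup>2 - 3) - Z))"
      unfolding P_eq by (simp add: algebra_simps power2_eq_square)
    then show "P t X Y w = (w - Z) * (w - (X * Y + of_real ((tau t)\<^sup>2 - 3) - Z))"
      using assms by simp
  qed
next
  fix Z' assume h: "\<forall>w. P t X Y w = (w - Z) * (w - Z')"
  \<comment> \<open>Evaluation at w = Z + 1, where the factor w - Z equals 1, isolates
    \<open>Z'\<close>.\<close>
  have "P t X Y (Z + 1) - P t X Y Z = Z + 1 - Z'" using h[rule_format, of "Z + 1"] assms by simp
  moreover have "P t X Y (Z + 1) - P t X Y Z = 2 * Z + 1 - (X * Y + of_real ((tau t)\<^sup>2 - 3))"
    unfolding P_eq by (simp add: algebra_simps power2_eq_square)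
  ultimately have "Z + 1 - Z' = 2 * Z + 1 - (X * Y + of_real ((tau t)\<^sup>2 - 3))" by metis
  then show "Z' = X * Y + of_real ((tau t)\<^sup>2 - 3) - Z" by algebra
qed

lemma P_conj:
  "P t (Complex A B) (Complex A (- B)) (Complex a b) =
   Complex (a\<^sup>2 - b\<^sup>2 - (A\<^sup>2 + B\<^sup>2 + (tau t)\<^sup>2 - 3) * a
     + (2 * A ^ 3 - 6 * A * B\<^sup>2 + ((tau t)\<^sup>2 - 6) * (A\<^sup>2 + B\<^sup>2) + 2 * tau t ^ 3 - 6 * (tau t)\<^sup>2 + 9))
    ((2 * a - (A\<^sup>2 + B\<^sup>2 + (tau t)\<^sup>2 - 3)) * b)"
  unfolding P_eq
  by (simp add: complex_eq_iff power2_eq_square power3_eq_cube algebra_simps)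

text \<open>By Vieta, \<open>cnj Z\<close> being the second root fixes Z + \<open>cnj Z\<close>,
  hence \<open>Re Z\<close>. Completing the square then turns the equation P = 0 into the one for
  \<open>Im Z\<close>.\<close>

lemma F_real_iff:
  "(X, Y, Z) \<in> F_real t \<longleftrightarrow> Y = cnj X \<and>
     Re Z = ((Re X)\<^sup>2 + (Im X)\<^sup>2 + (tau t)\<^sup>2 - 3) / 2 \<and> 4 * (Im Z)\<^sup>2 = - disc (tau t) (Re X) (Im X)"
proof (cases "Y = cnj X")
  case True
  obtain A B where X: "X = Complex A B" by (cases X)
  obtain a b where Z: "Z = Complex a b" by (cases Z)
  have Y: "Y = Complex A (- B)" using True X by (simp add: complex_eq_iff)
  have "(X, Y, Z) \<in> F_real t \<longleftrightarrow> P t X Y Z = 0 \<and> cnj Z = X * Y + of_real ((tau t)\<^sup>2 - 3) - Z"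
    using True second_root_eq[of t X Y Z] by (auto simp: F_real_def F_def)
  also have "cnj Z = X * Y + of_real ((tau t)\<^sup>2 - 3) - Z \<longleftrightarrow> a = (A\<^sup>2 + B\<^sup>2 + (tau t)\<^sup>2 - 3) / 2"
    by (auto simp: X Y Z complex_eq_iff power2_eq_square)
  also have "P t X Y Z = 0 \<and> a = (A\<^sup>2 + B\<^sup>2 + (tau t)\<^sup>2 - 3) / 2 \<longleftrightarrow>
      a = (A\<^sup>2 + B\<^sup>2 + (tau t)\<^sup>2 - 3) / 2 \<and> 4 * b\<^sup>2 = - disc (tau t) A B"
  proof -
    have "P t X Y Z = 0 \<longleftrightarrow> 4 * b\<^sup>2 = - disc (tau t) A B" if a: "a = (A\<^sup>2 + B\<^sup>2 + (tau t)\<^sup>2 - 3) / 2"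
    proof -
      have s: "A\<^sup>2 + B\<^sup>2 + (tau t)\<^sup>2 - 3 = 2 * a" using a by simp
      show ?thesis unfolding X Y Z P_conj disc_def s
        by (simp add: complex_eq_iff) (simp add: power2_eq_square algebra_simps, linarith)
    qed
    then show ?thesis by blast
  qed
  finally show ?thesis using True by (simp add: X Z)
qed (auto simp: F_real_def)

section \<open>The discriminant over the strip\<close>

text \<open>As a quadratic in B^2 the discriminant has the roots E + 4H and E - 4H. This links it to
  the bounds \<open>B1\<close>, ..., \<open>B4\<close>.\<close>

lemma disc_E_H: "disc (tau t) A B = (B\<^sup>2 - E t A)\<^sup>2 - 16 * ((A + (3 - tau t) / 2)\<^sup>2 * (2 * A + 2 * tau t + 3))"
  unfolding disc_def E_def cos_2pi cos_4pi
  by (simp add: field_simps power2_eq_square power3_eq_cube)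

lemma E_eq: "E t A = (tau t)\<^sup>2 - 9 - A\<^sup>2 - 12 * A"
  unfolding E_def cos_2pi cos_4pi by (simp add: field_simps power2_eq_square)

lemma H_eq: "H t A = sqrt ((A + (3 - tau t) / 2)\<^sup>2 * (2 * A + 2 * tau t + 3))"
  unfolding H_def cos_2pi by (simp add: field_simps)

lemma H_facts:
  assumes "0 < t" "t < 1 / 3" "- (3 - tau t) / 2 \<le> A"
  shows "0 \<le> H t A" "disc (tau t) A B = (B\<^sup>2 - E t A)\<^sup>2 - 16 * (H t A)\<^sup>2"
proof -
  have "0 \<le> 2 * A + 2 * tau t + 3" using assms tau_bounds[OF assms(1,2)] by (simp add: field_simps)
  then have nn: "0 \<le> (A + (3 - tau t) / 2)\<^sup>2 * (2 * A + 2 * tau t + 3)" by simp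
  show "0 \<le> H t A" unfolding H_eq using nn by simp
  show "disc (tau t) A B = (B\<^sup>2 - E t A)\<^sup>2 - 16 * (H t A)\<^sup>2"
    unfolding disc_E_H H_eq using nn by simp
qed

lemma disc_le_0_iff:
  assumes "0 < t" "t < 1 / 3" "- (3 - tau t) / 2 \<le> A"
  shows "disc (tau t) A B \<le> 0 \<longleftrightarrow> E t A - 4 * H t A \<le> B\<^sup>2 \<and> B\<^sup>2 \<le> E t A + 4 * H t A"
proof -
  note h = H_facts[OF assms]
  have "disc (tau t) A B \<le> 0 \<longleftrightarrow> (B\<^sup>2 - E t A)\<^sup>2 \<le> (4 * H t A)\<^sup>2"
    unfolding h(2) by (simp add: power_mult_distrib)
  also have "\<dots> \<longleftrightarrow> \<bar>B\<^sup>2 - E t A\<bar> \<le> 4 * H t A"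
    using h(1) by (metis abs_le_square_iff abs_of_nonneg mult_nonneg_nonneg zero_le_numeral)
  finally show ?thesis by auto
qed

text \<open>Here k stands for cos(pi t), so that tau = 4k^2 - 1. The double root 4(1 - k^2) = 3 -
  tau is the node on the real axis; the other roots are 4k^2 + 4k and 4k^2 - 4k, the latter being
  \<open>A_mid t\<close>.\<close>

lemma disc_real_axis:
  "disc (4 * k\<^sup>2 - 1) A 0 = (A - 4 * (1 - k\<^sup>2))\<^sup>2 * ((A - 4 * k\<^sup>2)\<^sup>2 - (4 * k)\<^sup>2)"
  unfolding disc_def by (simp add: power2_eq_square power3_eq_cube algebra_simps)

lemma A_mid_bounds:
  assumes "0 < t" "t < 1 / 3"
  shows "- (3 - tau t) / 2 < A_mid t" "A_mid t < 0"
proof -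
  note k = cos_pi_bounds[OF assms]
  have "0 < (1 - cos (pi * t)) * (1 - cos (pi * t))" using k by simp
  then show "- (3 - tau t) / 2 < A_mid t"
    by (simp add: A_mid_eq tau_cos_pi power2_eq_square field_simps)
  have "0 < cos (pi * t) * (1 - cos (pi * t))" using k by simp
  then show "A_mid t < 0" by (simp add: A_mid_eq power2_eq_square algebra_simps)
qed

text \<open>Left of \<open>A_mid t\<close> the discriminant is nonnegative at B = 0, that is, (4H)^2
  is at most E^2. Together with the sign of E this gives 4H \<le> E.\<close>

lemma E_ge_H_left:
  assumes "0 < t" "t < 1 / 3" "- (3 - tau t) / 2 \<le> A" "A \<le> A_mid t"
  shows "0 \<le> E t A - 4 * H t A"
proof -
  define k where "k = cos (pi * t)"
  have k: "1 / 2 < k" "k < 1" using cos_pi_bounds[OF assms(1,2)] by (auto simp: k_def)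
  have tau: "tau t = 4 * k\<^sup>2 - 1" by (simp add: k_def tau_cos_pi)
  have mid: "A_mid t = 4 * k\<^sup>2 - 4 * k" by (simp add: k_def A_mid_eq)
  note h = H_facts[OF assms(1-3)]
  have "0 \<le> disc (tau t) A 0"
  proof -
    have "A - 4 * k\<^sup>2 \<le> - (4 * k)" using assms(4) mid by simp
    then have "4 * k \<le> \<bar>A - 4 * k\<^sup>2\<bar>" using k by simp
    then have "(4 * k)\<^sup>2 \<le> (A - 4 * k\<^sup>2)\<^sup>2" using k
      by (metis abs_le_square_iff abs_of_pos less_trans mult_pos_pos zero_less_divide_1_iff zero_less_numeral)
    then show ?thesis unfolding tau disc_real_axis by simp
  qed
  then have sq: "(4 * H t A)\<^sup>2 \<le> (E t A)\<^sup>2" unfolding h(2) by (simp add: power_mult_distrib)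
  have E0: "E t (- (3 - tau t) / 2) = 3 * (3 - tau t)\<^sup>2 / 4"
    unfolding E_eq by (simp add: field_simps power2_eq_square)
  have E1: "E t (A_mid t) = 8 * (1 - k)\<^sup>2 * (4 * k - 1)"
    unfolding E_eq mid tau by (simp add: field_simps power2_eq_square)
  \<comment> \<open>E is concave in A, so on an interval it is bounded below by the smaller of its
    values at the endpoints.\<close>
  have conc: "E t A \<ge> min (E t l) (E t r)" if "l \<le> A" "A \<le> r" for l r
  proof (rule ccontr)
    assume "\<not> ?thesis"
    then have "E t A < E t l" "E t A < E t r" by auto
    then have "(A - l) * (A + l + 12) > 0" "(r - A) * (A + r + 12) < 0"
      unfolding E_eq by (simp_all add: algebra_simps power2_eq_square)
    with that have "A + l + 12 > 0" "A + r + 12 < 0"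
      by (auto simp: zero_less_mult_iff mult_less_0_iff)
    with that show False by simp
  qed
  have "0 \<le> E t (- (3 - tau t) / 2)" "0 \<le> E t (A_mid t)"
    unfolding E0 E1 using k by auto
  then have "0 \<le> E t A" using conc[OF assms(3,4)] by linarith
  then show ?thesis using power2_le_imp_le[OF sq] by simp
qed

text \<open>Between \<open>A_mid t\<close> and the node, A lies between the roots 4k^2 - 4k and 4k^2
  + 4k, so the discriminant is nonpositive at B = 0; both inequalities are the case B = 0 of
  \<open>disc_le_0_iff\<close>.\<close>

lemma E_le_H_right:
  assumes "0 < t" "t < 1 / 3" "A_mid t \<le> A" "A \<le> 3 - tau t"
  shows "E t A - 4 * H t A \<le> 0" "0 \<le> E t A + 4 * H t A"
proof -
  define k where "k = cos (pi * t)"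
  have k: "1 / 2 < k" "k < 1" using cos_pi_bounds[OF assms(1,2)] by (auto simp: k_def)
  have tau: "tau t = 4 * k\<^sup>2 - 1" by (simp add: k_def tau_cos_pi)
  have mid: "A_mid t = 4 * k\<^sup>2 - 4 * k" by (simp add: k_def A_mid_eq)
  have A: "- (3 - tau t) / 2 \<le> A" using A_mid_bounds[OF assms(1,2)] assms(3) by linarith
  \<comment> \<open>This is the statement that the node 4 - 4k^2 lies to the left of the root 4k^2 +
    4k.\<close>
  have "0 < (2 * k - 1) * (k + 1)" using k by simp
  then have "A - 4 * k\<^sup>2 \<le> 4 * k" using assms(4) tau by (simp add: algebra_simps power2_eq_square)
  moreover have "- (4 * k) \<le> A - 4 * k\<^sup>2" using assms(3) mid by simp
  ultimately have "\<bar>A - 4 * k\<^sup>2\<bar> \<le> \<bar>4 * k\<bar>" using k by auto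
  then have "(A - 4 * k\<^sup>2)\<^sup>2 \<le> (4 * k)\<^sup>2" by (simp add: abs_le_square_iff)
  then have "disc (tau t) A 0 \<le> 0" unfolding tau disc_real_axis by (simp add: mult_nonneg_nonpos)
  then show "E t A - 4 * H t A \<le> 0" "0 \<le> E t A + 4 * H t A"
    using disc_le_0_iff[OF assms(1,2) A, of 0] by auto
qed

text \<open>The three cases in the definition together say that the discriminant is nonpositive over
  the strip: left of \<open>A_mid t\<close> they confine the modulus of B to an interval, right of
  it the lower bound for B^2 is void.\<close>

lemma C_u_iff:
  assumes "0 < t" "t < 1 / 3"
  shows "(X, Y, Z) \<in> C_u t \<longleftrightarrow>
    (X, Y, Z) \<in> F_real t \<and> - (3 - tau t) / 2 \<le> Re X \<and> Re X \<le> 3 - tau t"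
proof -
  define T where "T A B \<longleftrightarrow>
        (cos (2 * pi * t) - 1 \<le> A \<and> A \<le> A_mid t \<and> B1 t A \<le> B \<and> B \<le> B2 t A \<or>
        cos (2 * pi * t) - 1 \<le> A \<and> A \<le> A_mid t \<and> B4 t A \<le> B \<and> B \<le> B3 t A \<or>
        A_mid t \<le> A \<and> A \<le> 4 * (sin (pi * t))\<^sup>2 \<and> B4 t A \<le> B \<and> B \<le> B2 t A)" for A B
  have c: "cos (2 * pi * t) - 1 = - (3 - tau t) / 2" unfolding cos_2pi by (simp add: field_simps)
  note mid = A_mid_bounds[OF assms] and tb = tau_bounds[OF assms]
  have T: "T A B \<longleftrightarrow> - (3 - tau t) / 2 \<le> A \<and> A \<le> 3 - tau t \<and> disc (tau t) A B \<le> 0" for A B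
  proof (cases "- (3 - tau t) / 2 \<le> A \<and> A \<le> 3 - tau t")
    case False
    then show ?thesis unfolding T_def c sin_pi_sq using mid tb by auto
  next
    case True
    then have A: "- (3 - tau t) / 2 \<le> A" by simp
    have le: "B\<^sup>2 \<le> x \<longleftrightarrow> \<bar>B\<bar> \<le> sqrt x" if "0 \<le> x" for x
      using that by (metis real_sqrt_abs real_sqrt_le_iff)
    \<comment> \<open>\<open>sqrt\<close> is increasing on all of the reals, with negative values at
      negative arguments, so the sign of x does not matter.\<close>
    have ge: "x \<le> B\<^sup>2 \<longleftrightarrow> sqrt x \<le> \<bar>B\<bar>" for x
      by (metis real_sqrt_abs real_sqrt_le_iff)
    show ?thesis
    proof (cases "A \<le> A_mid t")
      case True2: True
      have nn: "0 \<le> E t A - 4 * H t A" by (rule E_ge_H_left[OF assms A True2])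
      then have nn2: "0 \<le> E t A + 4 * H t A" using H_facts(1)[OF assms A] by simp
      have b: "disc (tau t) A B \<le> 0 \<longleftrightarrow> B1 t A \<le> \<bar>B\<bar> \<and> \<bar>B\<bar> \<le> B2 t A"
        unfolding disc_le_0_iff[OF assms A] ge le[OF nn2] B1_def B2_def ..
      have "0 \<le> B1 t A" "B1 t A \<le> B2 t A"
        using nn H_facts(1)[OF assms A] by (auto simp: B1_def B2_def)
      \<comment> \<open>At \<open>A_mid t\<close> all three cases of the definition apply; they
        agree because the inner bound vanishes there.\<close>
      moreover have "B1 t A = 0" if "A = A_mid t"
        using nn E_le_H_right(1)[OF assms, of A] that mid tb by (simp add: B1_def)
      ultimately show ?thesis using True True2 b unfolding T_def c sin_pi_sq B3_def B4_def by auto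
    next
      case False
      then have A2: "A_mid t \<le> A" "A \<le> 3 - tau t" using True by auto
      note nn = E_le_H_right[OF assms A2]
      have "E t A - 4 * H t A \<le> B\<^sup>2" using nn(1) by (meson order_trans zero_le_power2)
      then have "disc (tau t) A B \<le> 0 \<longleftrightarrow> \<bar>B\<bar> \<le> B2 t A"
        unfolding disc_le_0_iff[OF assms A] le[OF nn(2)] B2_def by simp
      then show ?thesis using True False unfolding T_def c sin_pi_sq B3_def B4_def by auto
    qed
  qed
  have "(X, Y, Z) \<in> C_u t \<longleftrightarrow> (X, Y, Z) \<in> F t \<and>
     (\<exists>A B :: real. X = of_real A + \<i> * of_real B \<and> Y = of_real A - \<i> * of_real B \<and> T A B)"
    by (simp add: C_u_def T_def)
  also have "\<dots> \<longleftrightarrow> (X, Y, Z) \<in> F t \<and> Y = cnj X \<and> T (Re X) (Im X)"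
    by (auto simp: complex_eq_iff)
  also have "\<dots> \<longleftrightarrow> (X, Y, Z) \<in> F_real t \<and> - (3 - tau t) / 2 \<le> Re X \<and> Re X \<le> 3 - tau t"
  proof
    assume l: "(X, Y, Z) \<in> F t \<and> Y = cnj X \<and> T (Re X) (Im X)"
    obtain A B where X: "X = Complex A B" by (cases X)
    obtain a b where Z: "Z = Complex a b" by (cases Z)
    have Y: "Y = Complex A (- B)" using l X by (simp add: complex_eq_iff)
    define S where "S = A\<^sup>2 + B\<^sup>2 + (tau t)\<^sup>2 - 3"
    define C where "C = 2 * A ^ 3 - 6 * A * B\<^sup>2 + ((tau t)\<^sup>2 - 6) * (A\<^sup>2 + B\<^sup>2)
      + 2 * tau t ^ 3 - 6 * (tau t)\<^sup>2 + 9"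
    have d: "disc (tau t) A B = S\<^sup>2 - 4 * C" by (simp add: disc_def S_def C_def)
    have d0: "disc (tau t) A B \<le> 0" using l T X by simp
    have "a\<^sup>2 - b\<^sup>2 - S * a + C = 0" "(2 * a - S) * b = 0"
      using l unfolding F_def X Y Z by (auto simp: P_conj complex_eq_iff S_def C_def)
    \<comment> \<open>A real root of a real quadratic with nonpositive discriminant is a double
      root.\<close>
    moreover have "2 * a = S" if "b = 0" "a\<^sup>2 - b\<^sup>2 - S * a + C = 0"
    proof -
      have "(2 * a - S)\<^sup>2 = S\<^sup>2 - 4 * C" using that by (simp add: power2_eq_square algebra_simps)
      then have "(2 * a - S)\<^sup>2 \<le> 0" using d0 d by simp
      then show ?thesis by simp
    qed
    ultimately have a: "2 * a = S" and "a\<^sup>2 - b\<^sup>2 - S * a + C = 0" by auto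
    then have "4 * b\<^sup>2 = 4 * C - S\<^sup>2" by (simp add: power2_eq_square algebra_simps flip: a)
    then have "(X, Y, Z) \<in> F_real t" unfolding F_real_iff using l a d by (simp add: X Z S_def)
    then show "(X, Y, Z) \<in> F_real t \<and> - (3 - tau t) / 2 \<le> Re X \<and> Re X \<le> 3 - tau t" using l T by auto
  next
    assume r: "(X, Y, Z) \<in> F_real t \<and> - (3 - tau t) / 2 \<le> Re X \<and> Re X \<le> 3 - tau t"
    then have "disc (tau t) (Re X) (Im X) \<le> 0" unfolding F_real_iff
      by (smt (verit) zero_le_power2)
    then show "(X, Y, Z) \<in> F t \<and> Y = cnj X \<and> T (Re X) (Im X)"
      using r T by (auto simp: F_real_def)
  qed
  finally show ?thesis .
qed

subsection \<open>The component\<close>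

lemma zeta3_eq: "zeta3 = Complex (- 1 / 2) (sqrt 3 / 2)"
proof -
  have "zeta3 = cis (2 * pi / 3)" by (simp add: zeta3_def cis_conv_exp mult_ac)
  then show ?thesis by (simp add: complex_eq_iff cos_120 sin_120)
qed

lemma zeta3_inverse: "inverse zeta3 = Complex (- 1 / 2) (- sqrt 3 / 2)"
  by (rule inverse_unique) (simp add: zeta3_eq complex_eq_iff)

lemma zeta3_square: "zeta3\<^sup>2 = Complex (- 1 / 2) (- sqrt 3 / 2)"
  by (simp add: zeta3_eq complex_eq_iff power2_eq_square)

lemma zeta3_inverse_square: "(inverse zeta3)\<^sup>2 = Complex (- 1 / 2) (sqrt 3 / 2)"
  by (simp add: zeta3_inverse complex_eq_iff power2_eq_square)

lemma F_sing_eq: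
  "F_sing t =
    {(Complex (3 - tau t) 0, Complex (3 - tau t) 0, of_real ((tau t)\<^sup>2 - 3 * tau t + 3)),
     (Complex (- (3 - tau t) / 2) (sqrt 3 * (3 - tau t) / 2),
      Complex (- (3 - tau t) / 2) (- sqrt 3 * (3 - tau t) / 2), of_real ((tau t)\<^sup>2 - 3 * tau t + 3)),
     (Complex (- (3 - tau t) / 2) (- sqrt 3 * (3 - tau t) / 2),
      Complex (- (3 - tau t) / 2) (sqrt 3 * (3 - tau t) / 2), of_real ((tau t)\<^sup>2 - 3 * tau t + 3))}"
proof -
  define r where "r = 3 - tau t"
  have c: "- 2 * cos (2 * pi * t) + 2 * cos (4 * pi * t) + 3 = (tau t)\<^sup>2 - 3 * tau t + 3"
    unfolding cos_2pi cos_4pi by (simp add: field_simps power2_eq_square)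
  have "F_sing t =
     (\<lambda>j. (of_real (3 - tau t) * zeta3 ^ j, of_real (3 - tau t) * inverse zeta3 ^ j,
       of_real ((tau t)\<^sup>2 - 3 * tau t + 3))) ` {0, 1, 2}"
    unfolding F_sing_def c sin_pi_sq by blast
  also have "\<dots> = {(Complex (3 - tau t) 0, Complex (3 - tau t) 0, of_real ((tau t)\<^sup>2 - 3 * tau t + 3)),
     (Complex (- (3 - tau t) / 2) (sqrt 3 * (3 - tau t) / 2),
      Complex (- (3 - tau t) / 2) (- sqrt 3 * (3 - tau t) / 2), of_real ((tau t)\<^sup>2 - 3 * tau t + 3)),
     (Complex (- (3 - tau t) / 2) (- sqrt 3 * (3 - tau t) / 2),
      Complex (- (3 - tau t) / 2) (sqrt 3 * (3 - tau t) / 2), of_real ((tau t)\<^sup>2 - 3 * tau t + 3))}"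
    unfolding image_insert image_empty zeta3_square zeta3_inverse_square power_0 power_one_right
    unfolding zeta3_inverse
    unfolding zeta3_eq complex_of_real_mult_Complex
    unfolding r_def[symmetric] by (simp add: mult.commute flip: complex_of_real_def)
  finally show ?thesis .
qed

lemma F_sing_Re:
  assumes "p \<in> F_sing t"
  shows "Re (fst p) = - (3 - tau t) / 2 \<or> Re (fst p) = 3 - tau t"
  using assms unfolding F_sing_eq by auto

text \<open>On the left line H vanishes and the discriminant is the square of B^2 - E; on the right
  line it is B^2 times a positive factor. It is therefore nonnegative on both, so at a point of
  \<open>F_real\<close> it vanishes, which fixes B^2 and makes Z real.\<close>

lemma F_sing_if_Re:
  assumes "0 < t" "t < 1 / 3" "p \<in> F_real t"
    and "Re (fst p) = - (3 - tau t) / 2 \<or> Re (fst p) = 3 - tau t"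
  shows "p \<in> F_sing t"
proof -
  obtain X Y Z where p: "p = (X, Y, Z)" by (cases p)
  have F: "Y = cnj X" "Re Z = ((Re X)\<^sup>2 + (Im X)\<^sup>2 + (tau t)\<^sup>2 - 3) / 2"
    "4 * (Im Z)\<^sup>2 = - disc (tau t) (Re X) (Im X)"
    using assms(3) unfolding p F_real_iff by auto
  note tb = tau_bounds[OF assms(1,2)]
  have "Im Z = 0 \<and> (Re X = 3 - tau t \<and> Im X = 0 \<or>
      Re X = - (3 - tau t) / 2 \<and> (Im X)\<^sup>2 = (sqrt 3 * (3 - tau t) / 2)\<^sup>2)"
    using assms(4)
  proof
    assume "Re (fst p) = - (3 - tau t) / 2"
    then have A: "Re X = - (3 - tau t) / 2" by (simp add: p)
    have "4 * (Im Z)\<^sup>2 + ((Im X)\<^sup>2 - E t (Re X))\<^sup>2 = 0"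
    proof -
      have "Re X + (3 - tau t) / 2 = 0" using A by (simp add: field_simps)
      then show ?thesis using F(3) unfolding disc_E_H by simp
    qed
    then have "Im Z = 0" "(Im X)\<^sup>2 = E t (Re X)"
      by (simp_all add: sum_power2_eq_zero_iff add_nonneg_eq_0_iff)
    then show ?thesis using A
      by (simp add: E_eq power_mult_distrib power_divide) (simp add: field_simps power2_eq_square)
  next
    assume "Re (fst p) = 3 - tau t"
    then have A: "Re X = 3 - tau t" by (simp add: p)
    have "disc (tau t) (Re X) (Im X) = (Im X)\<^sup>2 * ((Im X)\<^sup>2 + 36 * (3 - tau t))"
      unfolding disc_def A by (simp add: power2_eq_square power3_eq_cube algebra_simps)
    then have "4 * (Im Z)\<^sup>2 + (Im X)\<^sup>2 * ((Im X)\<^sup>2 + 36 * (3 - tau t)) = 0" using F(3) by simp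
    moreover have "0 \<le> (Im X)\<^sup>2 * ((Im X)\<^sup>2 + 36 * (3 - tau t))" using tb by simp
    moreover have "0 < (Im X)\<^sup>2 + 36 * (3 - tau t)" using tb by (simp add: add_nonneg_pos)
    ultimately have "Im Z = 0" "Im X = 0"
      by (simp_all add: add_nonneg_eq_0_iff)
    then show ?thesis using A by simp
  qed
  then have i: "Im Z = 0" and
    "(Re X = 3 - tau t \<and> Im X = 0) \<or>
     (Re X = - (3 - tau t) / 2 \<and> (Im X = sqrt 3 * (3 - tau t) / 2 \<or> Im X = - (sqrt 3 * (3 - tau t) / 2)))"
    by (auto simp: power2_eq_iff)
  then have c: "X = Complex (3 - tau t) 0 \<or> X = Complex (- (3 - tau t) / 2) (sqrt 3 * (3 - tau t) / 2)
     \<or> X = Complex (- (3 - tau t) / 2) (- sqrt 3 * (3 - tau t) / 2)"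
    by (auto simp: complex_eq_iff)
  then have "(Re X)\<^sup>2 + (Im X)\<^sup>2 = (3 - tau t)\<^sup>2"
    by (elim disjE) (simp_all add: power_mult_distrib power_divide power2_commute[of "tau t" 3])
  then have "Z = of_real ((tau t)\<^sup>2 - 3 * tau t + 3)"
    using i F(2) by (simp add: complex_eq_iff power2_eq_square algebra_simps)
  with c show ?thesis unfolding p F(1) F_sing_eq by (elim disjE) (simp_all add: complex_eq_iff)
qed

text \<open>\<open>C_u\<close> without the nodes, described by the open strip rather than by
  deletion, so that it is visibly relatively open in \<open>F_real\<close>.\<close>

definition C_u_star :: "real \<Rightarrow> (complex \<times> complex \<times> complex) set" where
  "C_u_star t = {p \<in> F_real t. - (3 - tau t) / 2 < Re (fst p) \<and> Re (fst p) < 3 - tau t}"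

lemma C_u_eq:
  assumes "0 < t" "t < 1 / 3"
  shows "C_u t = {p \<in> F_real t. - (3 - tau t) / 2 \<le> Re (fst p) \<and> Re (fst p) \<le> 3 - tau t}"
proof (rule set_eqI)
  fix p :: "complex \<times> complex \<times> complex"
  show "p \<in> C_u t \<longleftrightarrow> p \<in> {p \<in> F_real t. - (3 - tau t) / 2 \<le> Re (fst p) \<and> Re (fst p) \<le> 3 - tau t}"
    by (cases p) (simp add: C_u_iff[OF assms])
qed

lemma C_u_star_eq:
  assumes "0 < t" "t < 1 / 3"
  shows "C_u_star t = C_u t \<inter> F_star t"
proof -
  have "p \<in> F_star t \<longleftrightarrow> p \<notin> F_sing t" if "p \<in> F_real t" for p
    using that by (auto simp: F_star_def F_real_def)
  moreover have "p \<notin> F_sing t \<longleftrightarrow> Re (fst p) \<noteq> - (3 - tau t) / 2 \<and> Re (fst p) \<noteq> 3 - tau t"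
    if "p \<in> F_real t" for p
    using F_sing_Re[of p t] F_sing_if_Re[OF assms that] by auto
  ultimately show ?thesis unfolding C_u_eq[OF assms] C_u_star_def
    by (auto simp: less_le)
qed

text \<open>
  A parametrization of \<open>C_u t\<close> by four copies of a rectangle: \<open>h\<close> selects the sign of \<open>B\<close>, and
  \<open>s\<close> one of the two roots \<open>Z\<close>.
\<close>

definition B_param :: "real \<Rightarrow> real \<Rightarrow> real \<Rightarrow> real \<Rightarrow> real" where
  "B_param t h A l = h * ((1 - l) * sqrt (max 0 (E t A - 4 * H t A)) + l * sqrt (E t A + 4 * H t A))"

definition strip_param :: "real \<Rightarrow> real \<Rightarrow> real \<Rightarrow> real \<times> real \<Rightarrow> complex \<times> complex \<times> complex" where
  "strip_param t s h = (\<lambda>(A, l).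
     (of_real A + \<i> * of_real (B_param t h A l), of_real A - \<i> * of_real (B_param t h A l),
      of_real ((A\<^sup>2 + (B_param t h A l)\<^sup>2 + (tau t)\<^sup>2 - 3) / 2)
      + \<i> * of_real (s * sqrt (- disc (tau t) A (B_param t h A l)) / 2)))"

lemma continuous_on_strip_param: "continuous_on S (strip_param t s h)"
proof -
  have 1: "continuous_on S (\<lambda>p :: real \<times> real. B_param t h (fst p) (snd p))"
    unfolding B_param_def E_def H_def by (auto intro!: continuous_intros)
  show ?thesis
    unfolding strip_param_def disc_def case_prod_unfold by (auto intro!: continuous_intros 1)
qed

lemma E_plus_H_nonneg:
  assumes "0 < t" "t < 1 / 3" "- (3 - tau t) / 2 \<le> A" "A \<le> 3 - tau t"
  shows "0 \<le> E t A + 4 * H t A"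
proof (cases "A \<le> A_mid t")
  case True
  then show ?thesis using E_ge_H_left[OF assms(1-3)] H_facts(1)[OF assms(1-3)] by linarith
next
  case False
  then show ?thesis using E_le_H_right(2)[OF assms(1,2)] assms(4) by simp
qed

lemma disc_le_0_strip_param:
  assumes "0 < t" "t < 1 / 3" "- (3 - tau t) / 2 \<le> A" "A \<le> 3 - tau t"
  shows "disc (tau t) A B \<le> 0 \<longleftrightarrow> (\<exists>h\<in>{1, -1}. \<exists>l\<in>{0..1}. B = B_param t h A l)"
proof -
  \<comment> \<open>The truncation at 0 lets one formula serve both sides of \<open>A_mid t\<close>:
    on the right the argument may be negative, and \<open>sqrt\<close> would then be negative
    too.\<close>
  define x where "x = sqrt (max 0 (E t A - 4 * H t A))"
  define y where "y = sqrt (E t A + 4 * H t A)"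
  have x: "0 \<le> x" "x\<^sup>2 = max 0 (E t A - 4 * H t A)" by (simp_all add: x_def)
  have y: "0 \<le> y" "y\<^sup>2 = E t A + 4 * H t A"
    using E_plus_H_nonneg[OF assms] by (simp_all add: y_def)
  have xy: "x \<le> y"
    using H_facts(1)[OF assms(1-3)] E_plus_H_nonneg[OF assms] by (simp add: x_def y_def)
  have "disc (tau t) A B \<le> 0 \<longleftrightarrow> x\<^sup>2 \<le> \<bar>B\<bar>\<^sup>2 \<and> \<bar>B\<bar>\<^sup>2 \<le> y\<^sup>2"
    unfolding disc_le_0_iff[OF assms(1-3)] x y by auto
  also have "\<dots> \<longleftrightarrow> x \<le> \<bar>B\<bar> \<and> \<bar>B\<bar> \<le> y"
    using x(1) y(1) by (metis abs_ge_zero power2_le_imp_le power_mono)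
  also have "\<dots> \<longleftrightarrow> (\<exists>l\<in>{0..1}. \<bar>B\<bar> = (1 - l) * x + l * y)"
  proof -
    have "closed_segment x y = {x..y}" using xy by (simp add: closed_segment_eq_real_ivl)
    then have "x \<le> \<bar>B\<bar> \<and> \<bar>B\<bar> \<le> y \<longleftrightarrow> \<bar>B\<bar> \<in> closed_segment x y" by simp
    then show ?thesis by (auto simp: closed_segment_def)
  qed
  also have "\<dots> \<longleftrightarrow> (\<exists>h\<in>{1, -1}. \<exists>l\<in>{0..1}. B = h * ((1 - l) * x + l * y))"
  proof -
    have "\<bar>B\<bar> = (1 - l) * x + l * y \<longleftrightarrow> B = (1 - l) * x + l * y \<or> B = - ((1 - l) * x + l * y)"
      if "l \<in> {0..1}" for l
    proof -
      have "0 \<le> (1 - l) * x + l * y" using that x(1) y(1) by simp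
      then show ?thesis by linarith
    qed
    then show ?thesis by auto
  qed
  finally show ?thesis by (simp add: B_param_def x_def y_def)
qed

text \<open>The set J of abscissas is kept general in order to treat the open strip (connectedness)
  and the closed strip (compactness) at once.\<close>

lemma F_real_strip_param:
  assumes "0 < t" "t < 1 / 3" "J \<subseteq> {- (3 - tau t) / 2 .. 3 - tau t}"
  shows "{p \<in> F_real t. Re (fst p) \<in> J} =
    (\<Union>s\<in>{1, -1}. \<Union>h\<in>{1, -1}. strip_param t s h ` (J \<times> {0..1}))" (is "?L = ?R")
proof (intro equalityI subsetI)
  fix p assume p: "p \<in> ?L"
  obtain X Y Z where pe: "p = (X, Y, Z)" by (cases p)
  have F: "Y = cnj X" "Re Z = ((Re X)\<^sup>2 + (Im X)\<^sup>2 + (tau t)\<^sup>2 - 3) / 2"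
    "4 * (Im Z)\<^sup>2 = - disc (tau t) (Re X) (Im X)" and J: "Re X \<in> J"
    using p unfolding pe F_real_iff mem_Collect_eq by auto
  then have "disc (tau t) (Re X) (Im X) \<le> 0" by (smt (verit) zero_le_power2)
  moreover have "- (3 - tau t) / 2 \<le> Re X" "Re X \<le> 3 - tau t" using assms(3) J by auto
  ultimately obtain h l where hl: "h \<in> {1, -1}" "l \<in> {0..1}" "Im X = B_param t h (Re X) l"
    using disc_le_0_strip_param[OF assms(1,2), of "Re X" "Im X"] by metis
  have "(2 * Im Z)\<^sup>2 = - disc (tau t) (Re X) (Im X)" using F(3) by (simp add: power_mult_distrib)
  then have "\<bar>2 * Im Z\<bar> = sqrt (- disc (tau t) (Re X) (Im X))" by (metis real_sqrt_abs)
  then obtain s where s: "s \<in> {1, -1 :: real}" "Im Z = s * sqrt (- disc (tau t) (Re X) (Im X)) / 2"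
    by (cases "Im Z \<ge> 0") force+
  have "p = strip_param t s h (Re X, l)"
    unfolding pe strip_param_def by (simp add: complex_eq_iff F s(2) flip: hl(3))
  then show "p \<in> ?R" using s(1) hl J by blast
next
  fix p assume "p \<in> ?R"
  then obtain s h A l where 1: "s \<in> {1, -1}" "h \<in> {1, -1}" "A \<in> J" "l \<in> {0..1}" "p = strip_param t s h (A, l)"
    by blast
  then have d: "disc (tau t) A (B_param t h A l) \<le> 0"
    using disc_le_0_strip_param[OF assms(1,2), of A "B_param t h A l"] assms(3) by force
  have "s\<^sup>2 = 1" using 1(1) by auto
  then show "p \<in> ?L" using d 1(3)
    by (simp add: 1(5) strip_param_def F_real_iff complex_eq_iff power_divide power_mult_distrib)
qed

lemma C_u_star_strip_param:
  assumes "0 < t" "t < 1 / 3"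
  shows "C_u_star t = (\<Union>s\<in>{1, -1}. \<Union>h\<in>{1, -1}. strip_param t s h ` ({- (3 - tau t) / 2 <..< 3 - tau t} \<times> {0..1}))"
proof -
  have "{- (3 - tau t) / 2 <..< 3 - tau t} \<subseteq> {- (3 - tau t) / 2 .. 3 - tau t}" by auto
  from F_real_strip_param[OF assms this] show ?thesis unfolding C_u_star_def greaterThanLessThan_iff .
qed

lemma C_u_strip_param:
  assumes "0 < t" "t < 1 / 3"
  shows "C_u t = (\<Union>s\<in>{1, -1}. \<Union>h\<in>{1, -1}. strip_param t s h ` ({- (3 - tau t) / 2 .. 3 - tau t} \<times> {0..1}))"
  using F_real_strip_param[OF assms subset_refl] unfolding C_u_eq[OF assms] atLeastAtMost_iff .

text \<open>Four connected pieces are glued over A = 0. The two signs of B meet at l = 0, where the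
  truncated inner bound is 0; the two roots Z meet at l = 1, where the discriminant
  vanishes.\<close>

lemma connected_C_u_star:
  assumes "0 < t" "t < 1 / 3"
  shows "connected (C_u_star t)"
proof -
  define R where "R = {- (3 - tau t) / 2 <..< 3 - tau t} \<times> {0..1 :: real}"
  have R0: "(0, 0) \<in> R" "(0, 1) \<in> R" using tau_bounds[OF assms] by (auto simp: R_def)
  have A0: "A_mid t \<le> 0" "(0 :: real) \<le> 3 - tau t" "- (3 - tau t) / 2 \<le> 0"
    using A_mid_bounds[OF assms] tau_bounds[OF assms] by auto
  have "connected R"
    unfolding R_def by (intro connected_Times connected_Ioo connected_Icc)
  then have con: "connected (strip_param t s h ` R)" for s h
    by (intro connected_continuous_image continuous_on_strip_param)
  have "strip_param t s 1 (0, 0) = strip_param t s (-1) (0, 0)" for s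
    using E_le_H_right(1)[OF assms A0(1,2)] by (simp add: strip_param_def B_param_def)
  then have "strip_param t s 1 ` R \<inter> strip_param t s (-1) ` R \<noteq> {}" for s
    using R0(1) by (metis Int_iff empty_iff imageI)
  then have con2: "connected (strip_param t s 1 ` R \<union> strip_param t s (-1) ` R)" for s
    by (intro connected_Un con)
  have "disc (tau t) 0 (B_param t 1 0 1) = 0"
    unfolding H_facts(2)[OF assms A0(3)] B_param_def
    using E_plus_H_nonneg[OF assms A0(3,2)] by (simp add: power_mult_distrib)
  then have "strip_param t 1 1 (0, 1) = strip_param t (-1) 1 (0, 1)" by (simp add: strip_param_def)
  then have "(strip_param t 1 1 ` R \<union> strip_param t 1 (-1) ` R) \<inter> (strip_param t (-1) 1 ` R \<union> strip_param t (-1) (-1) ` R) \<noteq> {}"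
    using R0(2) by (metis Int_iff UnI1 empty_iff imageI)
  then have "connected ((strip_param t 1 1 ` R \<union> strip_param t 1 (-1) ` R) \<union> (strip_param t (-1) 1 ` R \<union> strip_param t (-1) (-1) ` R))"
    by (intro connected_Un con2)
  also have "(strip_param t 1 1 ` R \<union> strip_param t 1 (-1) ` R) \<union> (strip_param t (-1) 1 ` R \<union> strip_param t (-1) (-1) ` R) = C_u_star t"
    unfolding C_u_star_strip_param[OF assms] R_def by simp
  finally show ?thesis .
qed

text \<open>\<open>C_u\<close> is closed as a finite union of continuous images of compact
  rectangles. Conversely, each closed rectangle is the closure of the one over the open interval,
  and continuity carries closures into closures.\<close>

lemma closure_C_u_star:
  assumes "0 < t" "t < 1 / 3"
  shows "closure (C_u_star t) = C_u t"
proof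
  have "compact (C_u t)"
    unfolding C_u_strip_param[OF assms]
    by (intro compact_UN compact_continuous_image continuous_on_strip_param compact_Times compact_Icc) simp_all
  then show "closure (C_u_star t) \<subseteq> C_u t"
    by (intro closure_minimal compact_imp_closed) (auto simp: C_u_star_eq[OF assms])
  let ?J = "{- (3 - tau t) / 2 <..< 3 - tau t}"
  have "closure ?J = {- (3 - tau t) / 2 .. 3 - tau t}"
    using tau_bounds[OF assms] by (intro closure_greaterThanLessThan) simp
  then have cl: "{- (3 - tau t) / 2 .. 3 - tau t} \<times> {0..1 :: real} = closure (?J \<times> {0..1})"
    by (simp add: closure_Times)
  have "strip_param t s h ` closure (?J \<times> {0..1}) \<subseteq> closure (C_u_star t)" if "s \<in> {1, -1}" "h \<in> {1, -1}" for s h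
  proof (rule image_closure_subset[OF continuous_on_strip_param])
    have "strip_param t s h ` (?J \<times> {0..1}) \<subseteq> C_u_star t"
      unfolding C_u_star_strip_param[OF assms] using that by blast
    then show "strip_param t s h ` (?J \<times> {0..1}) \<subseteq> closure (C_u_star t)"
      using closure_subset by blast
  qed simp
  then show "C_u t \<subseteq> closure (C_u_star t)"
    unfolding C_u_strip_param[OF assms] cl by blast
qed

text \<open>Since the boundary lines of the strip carry only nodes, the open and the closed strip
  cut out the same part of \<open>F_real\<close> outside the nodes. Hence \<open>C_u_star\<close> is
  clopen in every connected set D containing it, which gives maximality.\<close>

lemma C_u_star_component:
  assumes "0 < t" "t < 1 / 3"
  shows "C_u_star t \<in> components (F_real t \<inter> F_star t)"
  unfolding in_components_maximal
proof (intro conjI allI impI connected_C_u_star assms)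
  have "(0, 0) \<in> {- (3 - tau t) / 2 <..< 3 - tau t} \<times> {0..1 :: real}"
    using tau_bounds[OF assms] by simp
  then have "strip_param t 1 1 (0, 0) \<in> C_u_star t"
    unfolding C_u_star_strip_param[OF assms] by blast
  then show ne: "C_u_star t \<noteq> {}" by blast
  define U where "U = {p :: complex \<times> complex \<times> complex. - (3 - tau t) / 2 < Re (fst p) \<and> Re (fst p) < 3 - tau t}"
  define K where "K = {p :: complex \<times> complex \<times> complex. - (3 - tau t) / 2 \<le> Re (fst p) \<and> Re (fst p) \<le> 3 - tau t}"
  have "open U" unfolding U_def by (intro open_Collect_conj open_Collect_less continuous_intros)
  moreover have "closed K" unfolding K_def
    by (intro closed_Collect_conj closed_Collect_le continuous_intros)
  moreover have cU: "C_u_star t = F_real t \<inter> U" unfolding C_u_star_def U_def by blast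
  moreover have "C_u t = F_real t \<inter> K" unfolding C_u_eq[OF assms] K_def by blast
  moreover note C_u_star_eq[OF assms]
  moreover from calculation show sub: "C_u_star t \<subseteq> F_real t \<inter> F_star t" by blast
  fix D assume D: "D \<noteq> {} \<and> C_u_star t \<subseteq> D \<and> D \<subseteq> F_real t \<inter> F_star t \<and> connected D"
  ultimately have "C_u_star t = D \<inter> U" "C_u_star t = D \<inter> K" by blast+
  then have "openin (top_of_set D) (C_u_star t)" "closedin (top_of_set D) (C_u_star t)"
    using \<open>open U\<close> \<open>closed K\<close> by (metis openin_open_Int, metis closedin_closed_Int)
  then show "D = C_u_star t" using D ne connected_clopen[of D] by blast
qed

lemma C_u_closed_component:
  assumes "0 < t" "t < 1 / 3"
  shows "C_u t \<in> closed_components t"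
  unfolding closed_components_def using C_u_star_component[OF assms] closure_C_u_star[OF assms] by blast

subsection \<open>Positivity\<close>

text \<open>Only the modulus of X and the real part of X^3 enter, which exhibits the threefold
  symmetry.\<close>

lemma disc_eq_norm:
  "disc \<tau> (Re X) (Im X) = ((cmod X)\<^sup>2 + \<tau>\<^sup>2 - 3)\<^sup>2
     - 4 * (2 * Re (X ^ 3) + (\<tau>\<^sup>2 - 6) * (cmod X)\<^sup>2 + 2 * \<tau> ^ 3 - 6 * \<tau>\<^sup>2 + 9)"
  unfolding disc_def cmod_power2
  by (simp add: power3_eq_cube power2_eq_square algebra_simps)

lemma disc_rotate:
  assumes "l ^ 3 = 1"
  shows "disc \<tau> (Re (l * X)) (Im (l * X)) = disc \<tau> (Re X) (Im X)"
proof -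
  have "cmod l = 1" using assms by (metis norm_one norm_power power_eq_1_iff zero_neq_numeral norm_ge_zero)
  then show ?thesis unfolding disc_eq_norm by (simp add: norm_mult power_mult_distrib assms)
qed

text \<open>
  Up to the factor \<open>1 / 9\<close> this is one of the sums \<open>r i j + r j i\<close>, for \<open>l\<close> a cube root of unity. It is
  positive on the disk of center \<open>2 * \<tau> * cnj l\<close> whose boundary passes through two of the nodes.
\<close>

definition disk_gap :: "real \<Rightarrow> complex \<Rightarrow> complex \<Rightarrow> real" where
  "disk_gap \<tau> l X = 9 - \<tau>\<^sup>2 - (cmod X)\<^sup>2 + 4 * \<tau> * Re (l * X)"

text \<open>The subtracted square is that of the disk gap for l = 1. Where the gap vanishes and the
  discriminant is nonpositive, both remaining squares must vanish.\<close>

lemma disc_sum_of_squares: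
  "3 * disc \<tau> A B = 4 * ((\<tau>\<^sup>2 - 3 * \<tau> - \<tau> * A + A\<^sup>2 - B\<^sup>2 - 3 * A)\<^sup>2 + (B * (2 * A + 3 - \<tau>))\<^sup>2)
     - (9 - \<tau>\<^sup>2 - A\<^sup>2 - B\<^sup>2 + 4 * \<tau> * A)\<^sup>2"
  unfolding disc_def by (simp add: power2_eq_square power3_eq_cube algebra_simps)

lemma disk_gap_zero_real:
  assumes \<tau>: "0 < \<tau>" "\<tau> < 3"
    and d: "disc \<tau> A B \<le> 0" and w: "9 - \<tau>\<^sup>2 - A\<^sup>2 - B\<^sup>2 + 4 * \<tau> * A = 0"
  shows "A = - (3 - \<tau>) / 2" "B\<^sup>2 = 3 * (3 - \<tau>)\<^sup>2 / 4"
proof -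
  have "(\<tau>\<^sup>2 - 3 * \<tau> - \<tau> * A + A\<^sup>2 - B\<^sup>2 - 3 * A)\<^sup>2 + (B * (2 * A + 3 - \<tau>))\<^sup>2 \<le> 0"
    using d disc_sum_of_squares[of \<tau> A B] unfolding w by simp
  then have r: "\<tau>\<^sup>2 - 3 * \<tau> - \<tau> * A + A\<^sup>2 - B\<^sup>2 - 3 * A = 0" and i: "B * (2 * A + 3 - \<tau>) = 0"
    by (simp_all only: sum_power2_le_zero_iff)
  show A: "A = - (3 - \<tau>) / 2"
  proof (rule ccontr)
    assume "A \<noteq> - (3 - \<tau>) / 2"
    then have B: "B = 0" using i by auto
    have lin: "A * (\<tau> - 1) = \<tau> - 3"
      using r w unfolding B by (simp add: power2_eq_square algebra_simps)
    \<comment> \<open>A is eliminated between the circle and the linear relation by multiplying with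
      (tau - 1)^2; dividing by tau - 1 is not possible because tau = 1 is allowed.\<close>
    have "(\<tau> - 1)\<^sup>2 * (9 - \<tau>\<^sup>2 - A\<^sup>2 + 4 * \<tau> * A) = 0" using w B by simp
    then have "(\<tau> - 1)\<^sup>2 * (9 - \<tau>\<^sup>2) - (A * (\<tau> - 1))\<^sup>2 + 4 * \<tau> * (\<tau> - 1) * (A * (\<tau> - 1)) = 0"
      by (simp add: power2_eq_square algebra_simps)
    then have "\<tau>\<^sup>2 * (\<tau> - 3)\<^sup>2 = 0" unfolding lin by (simp add: power2_eq_square algebra_simps)
    then show False using \<tau> by simp
  qed
  show "B\<^sup>2 = 3 * (3 - \<tau>)\<^sup>2 / 4"
    using r unfolding A by (simp add: power2_eq_square field_simps)
qed

text \<open>Rotation by l reduces a zero to the case l = 1. Passing to cubes removes l again: X^3 =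
  (3 - tau)^3, so X is the first coordinate of a node, and none of these lies in the open
  strip.\<close>

lemma disk_gap_nonzero:
  assumes \<tau>: "0 < \<tau>" "\<tau> < 3" and l: "l ^ 3 = 1"
    and d: "disc \<tau> (Re X) (Im X) \<le> 0" and X: "- (3 - \<tau>) / 2 < Re X" "Re X < 3 - \<tau>"
  shows "disk_gap \<tau> l X \<noteq> 0"
proof
  assume w: "disk_gap \<tau> l X = 0"
  have "cmod l = 1" using l by (metis norm_one norm_power power_eq_1_iff zero_neq_numeral norm_ge_zero)
  then have n: "(cmod X)\<^sup>2 = (Re (l * X))\<^sup>2 + (Im (l * X))\<^sup>2"
    by (metis cmod_power2 norm_mult mult_1)
  define A B r where "A = Re (l * X)" and "B = Im (l * X)" and "r = 3 - \<tau>"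
  have AB: "A = - r / 2" "B\<^sup>2 = 3 * r\<^sup>2 / 4"
    unfolding A_def B_def r_def
    using disk_gap_zero_real[OF \<tau>, of "Re (l * X)" "Im (l * X)"] w d
    unfolding disk_gap_def n disc_rotate[OF l] by auto
  have "(l * X) ^ 3 = Complex (A * (A\<^sup>2 - 3 * B\<^sup>2)) (B * (3 * A\<^sup>2 - B\<^sup>2))"
    unfolding A_def B_def by (simp add: complex_eq_iff power3_eq_cube power2_eq_square algebra_simps)
  also have "\<dots> = of_real (r ^ 3)"
    unfolding AB by (simp add: complex_eq_iff power3_eq_cube power2_eq_square)
  finally have X3: "X ^ 3 = of_real (r ^ 3)" by (simp add: power_mult_distrib l)
  define a b where "a = Re X" and "b = Im X"
  have "X ^ 3 = Complex (a * (a\<^sup>2 - 3 * b\<^sup>2)) (b * (3 * a\<^sup>2 - b\<^sup>2))"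
    unfolding a_def b_def by (simp add: complex_eq_iff power3_eq_cube power2_eq_square algebra_simps)
  then have re: "a * (a\<^sup>2 - 3 * b\<^sup>2) = r ^ 3" and im: "b = 0 \<or> b\<^sup>2 = 3 * a\<^sup>2"
    using X3 by (auto simp: complex_eq_iff)
  have cube: "x = r" if "x ^ 3 = r ^ 3" for x
    using that odd_real_root_power_cancel[of 3] by (metis odd_numeral)
  from im have "a = r \<or> - 2 * a = r"
  proof
    assume "b = 0"
    then show ?thesis using re cube[of a] by (simp add: power3_eq_cube power2_eq_square mult.assoc)
  next
    assume "b\<^sup>2 = 3 * a\<^sup>2"
    then show ?thesis using re cube[of "- 2 * a"] by (simp add: power3_eq_cube power2_eq_square)
  qed
  then show False using X by (auto simp: a_def r_def)
qed

text \<open>Intermediate values on a connected set: the gap has no zero, and at X = 0 it is 9 -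
  tau^2, which is positive.\<close>

lemma disk_gap_pos_C_u_star:
  assumes t: "0 < t" "t < 1 / 3" and l: "l ^ 3 = 1" and p: "p \<in> C_u_star t"
  shows "0 < disk_gap (tau t) l (fst p)"
proof (rule ccontr)
  assume neg: "\<not> ?thesis"
  note tb = tau_bounds[OF t]
  define f where "f q = disk_gap (tau t) l (fst q)" for q :: "complex \<times> complex \<times> complex"
  have cont: "continuous_on (C_u_star t) f"
    unfolding f_def disk_gap_def by (intro continuous_intros)
  have con: "connected (f ` C_u_star t)" by (intro connected_continuous_image cont connected_C_u_star t)
  have "strip_param t 1 1 (0, 0) \<in> C_u_star t"
    unfolding C_u_star_strip_param[OF t] using tb by force
  moreover have "strip_param t 1 1 (0, 0) = (0, 0, snd (snd (strip_param t 1 1 (0, 0))))"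
    using E_le_H_right(1)[OF t, of 0] A_mid_bounds[OF t] tb by (simp add: strip_param_def B_param_def)
  moreover have "0 < f (0, 0, z)" for z
  proof -
    have "tau t * tau t < 3 * 3" using tb by (intro mult_strict_mono) auto
    then show ?thesis by (simp add: f_def disk_gap_def power2_eq_square)
  qed
  ultimately obtain q where q: "q \<in> C_u_star t" "0 < f q" by metis
  have "f p \<le> 0" using neg by (simp add: f_def)
  then have "0 \<in> f ` C_u_star t"
    using connectedD_interval[OF con, of "f p" "f q" 0] p q by simp
  then obtain x where x: "x \<in> C_u_star t" "f x = 0" by auto
  obtain X Y Z where xe: "x = (X, Y, Z)" by (cases x)
  have "disc (tau t) (Re X) (Im X) \<le> 0"
  proof -
    have "4 * (Im Z)\<^sup>2 = - disc (tau t) (Re X) (Im X)"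
      using x(1) by (simp add: xe C_u_star_def F_real_iff)
    then show ?thesis by (smt (verit) zero_le_power2)
  qed
  then have "f x \<noteq> 0"
    using disk_gap_nonzero[OF tb l, of X] x(1) by (simp add: f_def xe C_u_star_def)
  then show False using x by simp
qed

lemma disk_gap_nonneg_C_u:
  assumes t: "0 < t" "t < 1 / 3" and l: "l ^ 3 = 1" and p: "p \<in> C_u t"
  shows "0 \<le> disk_gap (tau t) l (fst p)"
proof -
  have "closed {p :: complex \<times> complex \<times> complex. 0 \<le> disk_gap (tau t) l (fst p)}"
    unfolding disk_gap_def by (intro closed_Collect_le continuous_intros)
  moreover have "C_u_star t \<subseteq> {p. 0 \<le> disk_gap (tau t) l (fst p)}"
    using disk_gap_pos_C_u_star[OF t l] by (simp add: subset_iff less_imp_le)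
  ultimately show ?thesis
    using p closure_minimal unfolding closure_C_u_star[OF t, symmetric] by blast
qed

subsection \<open>Three by three matrices\<close>

lemma cmat3_eq_iff:
  "A = (B :: cmat3) \<longleftrightarrow> A $ 1 $ 1 = B $ 1 $ 1 \<and> A $ 1 $ 2 = B $ 1 $ 2 \<and> A $ 1 $ 3 = B $ 1 $ 3
     \<and> A $ 2 $ 1 = B $ 2 $ 1 \<and> A $ 2 $ 2 = B $ 2 $ 2 \<and> A $ 2 $ 3 = B $ 2 $ 3
     \<and> A $ 3 $ 1 = B $ 3 $ 1 \<and> A $ 3 $ 2 = B $ 3 $ 2 \<and> A $ 3 $ 3 = B $ 3 $ 3"
  by (auto simp: vec_eq_iff forall_3)

lemma matrix_mult_3_nth:
  "((A :: cmat3) ** B) $ i $ j = A $ i $ 1 * B $ 1 $ j + A $ i $ 2 * B $ 2 $ j + A $ i $ 3 * B $ 3 $ j"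
  by (simp add: matrix_matrix_mult_def sum_3)

lemma trace_3: "trace (A :: cmat3) = A $ 1 $ 1 + A $ 2 $ 2 + A $ 3 $ 3"
  by (simp add: trace_def sum_3)

lemma mat_3_nth:
  "(mat 1 :: cmat3) $ 1 $ 1 = 1" "(mat 1 :: cmat3) $ 1 $ 2 = 0" "(mat 1 :: cmat3) $ 1 $ 3 = 0"
  "(mat 1 :: cmat3) $ 2 $ 1 = 0" "(mat 1 :: cmat3) $ 2 $ 2 = 1" "(mat 1 :: cmat3) $ 2 $ 3 = 0"
  "(mat 1 :: cmat3) $ 3 $ 1 = 0" "(mat 1 :: cmat3) $ 3 $ 2 = 0" "(mat 1 :: cmat3) $ 3 $ 3 = 1"
  by (simp_all add: mat_def)

definition mat3 :: "complex \<Rightarrow> complex \<Rightarrow> complex \<Rightarrow> complex \<Rightarrow> complex \<Rightarrow> complex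
    \<Rightarrow> complex \<Rightarrow> complex \<Rightarrow> complex \<Rightarrow> cmat3" where
  "mat3 a b c d e f g h i = vector [vector [a, b, c], vector [d, e, f], vector [g, h, i]]"

lemma mat3_nth [simp]:
  "mat3 a b c d e f g h i $ 1 $ 1 = a" "mat3 a b c d e f g h i $ 1 $ 2 = b"
  "mat3 a b c d e f g h i $ 1 $ 3 = c" "mat3 a b c d e f g h i $ 2 $ 1 = d"
  "mat3 a b c d e f g h i $ 2 $ 2 = e" "mat3 a b c d e f g h i $ 2 $ 3 = f"
  "mat3 a b c d e f g h i $ 3 $ 1 = g" "mat3 a b c d e f g h i $ 3 $ 2 = h"
  "mat3 a b c d e f g h i $ 3 $ 3 = i"
  by (simp_all add: mat3_def vector_3)

lemma diag3_eq: "diag3 a b c = mat3 a 0 0 0 b 0 0 0 c"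
  by (simp add: diag3_def mat3_def)

text \<open>The adjugate, written out so that the entries of an inverse in \<open>SL3\<close> become
  polynomials.\<close>

definition adj3 :: "cmat3 \<Rightarrow> cmat3" where
  "adj3 M = mat3
     (M $ 2 $ 2 * M $ 3 $ 3 - M $ 2 $ 3 * M $ 3 $ 2)
     (M $ 1 $ 3 * M $ 3 $ 2 - M $ 1 $ 2 * M $ 3 $ 3)
     (M $ 1 $ 2 * M $ 2 $ 3 - M $ 1 $ 3 * M $ 2 $ 2)
     (M $ 2 $ 3 * M $ 3 $ 1 - M $ 2 $ 1 * M $ 3 $ 3)
     (M $ 1 $ 1 * M $ 3 $ 3 - M $ 1 $ 3 * M $ 3 $ 1)
     (M $ 1 $ 3 * M $ 2 $ 1 - M $ 1 $ 1 * M $ 2 $ 3)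
     (M $ 2 $ 1 * M $ 3 $ 2 - M $ 2 $ 2 * M $ 3 $ 1)
     (M $ 1 $ 2 * M $ 3 $ 1 - M $ 1 $ 1 * M $ 3 $ 2)
     (M $ 1 $ 1 * M $ 2 $ 2 - M $ 1 $ 2 * M $ 2 $ 1)"

lemma matrix_inv_unique:
  assumes "A ** B = mat 1"
  shows "matrix_inv (A :: cmat3) = B"
proof -
  have B: "B ** A = mat 1" using assms matrix_left_right_inverse by blast
  have "A ** matrix_inv A = mat 1 \<and> matrix_inv A ** A = mat 1"
    unfolding matrix_inv_def using assms B by (rule someI[where x = B, OF conjI])
  then have "matrix_inv A ** A ** B = B" by simp
  then show ?thesis using assms by (simp flip: matrix_mul_assoc)
qed

lemma SL3_inv:
  assumes "A \<in> SL3"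
  shows "A ** matrix_inv A = mat 1" "matrix_inv A ** A = mat 1" "matrix_inv A \<in> SL3"
    "matrix_inv (matrix_inv A) = A"
proof -
  have "invertible A" using assms by (simp add: SL3_def invertible_det_nz)
  then obtain B where B: "A ** B = mat 1" "B ** A = mat 1" by (auto simp: invertible_def)
  show i: "A ** matrix_inv A = mat 1" "matrix_inv A ** A = mat 1"
    using B matrix_inv_unique[OF B(1)] by simp_all
  have "det (A ** matrix_inv A) = 1" unfolding i by simp
  then show "matrix_inv A \<in> SL3" using assms by (simp add: SL3_def det_mul)
  show "matrix_inv (matrix_inv A) = A" by (rule matrix_inv_unique[OF i(2)])
qed

lemma matrix_inv_SL3:
  assumes "M \<in> SL3"
  shows "matrix_inv M = adj3 M"
proof (rule matrix_inv_unique)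
  have d: "det M = 1" using assms by (simp add: SL3_def)
  then show "M ** adj3 M = mat 1"
    unfolding cmat3_eq_iff matrix_mult_3_nth adj3_def mat3_nth mat_3_nth
    by (simp add: det_3 algebra_simps)
qed

lemma SL3_mult: "A \<in> SL3 \<Longrightarrow> B \<in> SL3 \<Longrightarrow> A ** B \<in> SL3"
  by (simp add: SL3_def det_mul)

lemma matrix_inv_mult:
  assumes "A \<in> SL3" "B \<in> SL3"
  shows "matrix_inv (A ** B) = matrix_inv B ** matrix_inv A"
proof (rule matrix_inv_unique)
  have "A ** B ** (matrix_inv B ** matrix_inv A) = A ** (B ** matrix_inv B) ** matrix_inv A"
    by (simp add: matrix_mul_assoc)
  then show "A ** B ** (matrix_inv B ** matrix_inv A) = mat 1"
    using SL3_inv[OF assms(1)] SL3_inv[OF assms(2)] by simp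
qed

lemma conj_transpose_nth [simp]: "conj_transpose A $ i $ j = cnj (A $ j $ i)"
  by (simp add: conj_transpose_def)

lemma conj_transpose_mult: "conj_transpose (A ** B) = conj_transpose B ** conj_transpose A"
  by (simp add: vec_eq_iff matrix_matrix_mult_def mult.commute)

lemma det_conj_transpose: "det (conj_transpose A) = cnj (det A)"
  by (simp add: det_3 algebra_simps)

section \<open>Unit rows and determinant 1: the equality case of Hadamard's inequality\<close>

text \<open>The left side is the determinant of a Hermitian matrix with unit diagonal and
  off-diagonal entries x, y, z. The value 1 gives |x|^2 + |y|^2 + |z|^2 = 2 Re(xyz), and |x| \<le> 1
  bounds the right side by 2 |y| |z|, hence by |y|^2 + |z|^2.\<close>

lemma gram_zero:
  fixes x y z :: complex
  assumes "1 + x * y * z + cnj (x * y * z) - x * cnj x - y * cnj y - z * cnj z = 1"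
    and "cmod x \<le> 1" "cmod y \<le> 1" "cmod z \<le> 1"
  shows "x = 0"
proof -
  have "x * y * z + cnj (x * y * z) = x * cnj x + y * cnj y + z * cnj z"
    using assms(1) by (simp add: algebra_simps)
  then have "complex_of_real (2 * Re (x * y * z)) = of_real ((cmod x)\<^sup>2 + (cmod y)\<^sup>2 + (cmod z)\<^sup>2)"
    unfolding complex_add_cnj complex_norm_square[symmetric] by simp
  then have "(cmod x)\<^sup>2 + (cmod y)\<^sup>2 + (cmod z)\<^sup>2 = 2 * Re (x * y * z)"
    by (metis of_real_eq_iff)
  also have "\<dots> \<le> 2 * (cmod x * (cmod y * cmod z))"
    using complex_Re_le_cmod[of "x * y * z"] by (simp add: norm_mult mult.assoc)
  also have "\<dots> \<le> 2 * (1 * (cmod y * cmod z))"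
    using assms(2) by (intro mult_left_mono mult_right_mono) auto
  also have "\<dots> \<le> (cmod y)\<^sup>2 + (cmod z)\<^sup>2"
    using sum_squares_bound[of "cmod y" "cmod z"] by (simp add: mult.assoc)
  finally show ?thesis by simp
qed

lemma cmod_row_product_le_1:
  fixes a b c d e f :: complex
  assumes "a * cnj a + b * cnj b + c * cnj c = 1" "d * cnj d + e * cnj e + f * cnj f = 1"
  shows "cmod (a * cnj d + b * cnj e + c * cnj f) \<le> 1"
proof -
  have n: "(cmod a)\<^sup>2 + (cmod b)\<^sup>2 + (cmod c)\<^sup>2 = 1" "(cmod d)\<^sup>2 + (cmod e)\<^sup>2 + (cmod f)\<^sup>2 = 1"
    using assms unfolding complex_norm_square[symmetric] by (metis of_real_add of_real_eq_1_iff)+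
  have "cmod (a * cnj d + b * cnj e + c * cnj f) \<le> cmod a * cmod d + cmod b * cmod e + cmod c * cmod f"
    by (intro order_trans[OF norm_triangle_ineq] add_mono) (simp_all add: norm_mult)
  moreover have "2 * (cmod a * cmod d) \<le> (cmod a)\<^sup>2 + (cmod d)\<^sup>2"
    "2 * (cmod b * cmod e) \<le> (cmod b)\<^sup>2 + (cmod e)\<^sup>2" "2 * (cmod c * cmod f) \<le> (cmod c)\<^sup>2 + (cmod f)\<^sup>2"
    using sum_squares_bound by (simp_all add: mult.assoc[symmetric])
  ultimately show ?thesis using n by linarith
qed

text \<open>The Gram matrix of the rows has unit diagonal and determinant |det M|^2 = 1, so
  \<open>gram_zero\<close>, applied cyclically, kills its off-diagonal entries.\<close>

lemma SU3_if_unit_rows: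
  assumes "det M = 1"
    and rows: "\<And>i. (cmod (M $ i $ 1))\<^sup>2 + (cmod (M $ i $ 2))\<^sup>2 + (cmod (M $ i $ 3))\<^sup>2 = 1"
  shows "M \<in> SU3"
proof -
  define G where "G = M ** conj_transpose M"
  have G: "G $ i $ j = M $ i $ 1 * cnj (M $ j $ 1) + M $ i $ 2 * cnj (M $ j $ 2) + M $ i $ 3 * cnj (M $ j $ 3)" for i j
    by (simp add: G_def matrix_mult_3_nth)
  have diag: "G $ i $ i = 1" for i
    unfolding G complex_norm_square[symmetric] using rows[of i] by (metis of_real_1 of_real_add)
  have herm: "G $ j $ i = cnj (G $ i $ j)" for i j
    unfolding G by (simp add: mult.commute)
  have le: "cmod (G $ i $ j) \<le> 1" for i j
    unfolding G using diag[of i] diag[of j] unfolding G by (rule cmod_row_product_le_1)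
  define x y z where "x = G $ 1 $ 2" and "y = G $ 2 $ 3" and "z = G $ 3 $ 1"
  have o: "G $ 2 $ 1 = cnj x" "G $ 3 $ 2 = cnj y" "G $ 1 $ 3 = cnj z"
    unfolding x_def y_def z_def by (rule herm)+
  have "det G = 1" by (simp add: G_def det_mul det_conj_transpose assms(1))
  then have "1 + x * y * z + cnj (x * y * z) - x * cnj x - y * cnj y - z * cnj z = 1"
    unfolding det_3 diag o x_def[symmetric] y_def[symmetric] z_def[symmetric] by (simp add: algebra_simps)
  then have "x = 0" "y = 0" "z = 0"
    using gram_zero[of x y z] gram_zero[of y z x] gram_zero[of z x y] le
    by (simp_all add: x_def y_def z_def algebra_simps)
  then have "G = mat 1"
    unfolding cmat3_eq_iff mat_3_nth diag o by (simp add: x_def y_def z_def)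
  then show ?thesis
    using assms(1) matrix_left_right_inverse[of M] by (auto simp: SU3_def SL3_def G_def)
qed

lemma SU3_diag3:
  assumes "cmod a = 1" "cmod b = 1" "cmod c = 1" "a * b * c = 1"
  shows "diag3 a b c \<in> SU3"
proof (rule SU3_if_unit_rows)
  show "det (diag3 a b c) = 1" using assms(4) by (simp add: det_3 diag3_eq)
  have "\<forall>i. (cmod (diag3 a b c $ i $ 1))\<^sup>2 + (cmod (diag3 a b c $ i $ 2))\<^sup>2 + (cmod (diag3 a b c $ i $ 3))\<^sup>2 = 1"
    unfolding forall_3 by (simp add: diag3_eq assms)
  then show "(cmod (diag3 a b c $ i $ 1))\<^sup>2 + (cmod (diag3 a b c $ i $ 2))\<^sup>2 + (cmod (diag3 a b c $ i $ 3))\<^sup>2 = 1" for i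
    by blast
qed

lemma SU3_inv_eq: "A \<in> SU3 \<Longrightarrow> matrix_inv A = conj_transpose A"
  by (rule matrix_inv_unique) (simp add: SU3_def matrix_left_right_inverse)

lemma SU3_subset_SL3: "SU3 \<subseteq> SL3"
  by (auto simp: SU3_def)

lemma SU3_mult:
  assumes "A \<in> SU3" "B \<in> SU3"
  shows "A ** B \<in> SU3"
proof -
  have "conj_transpose (A ** B) ** (A ** B) = conj_transpose B ** (conj_transpose A ** A) ** B"
    by (simp add: conj_transpose_mult matrix_mul_assoc)
  then show ?thesis using assms by (auto simp: SU3_def SL3_mult)
qed

lemma SU3_inv:
  assumes "A \<in> SU3"
  shows "matrix_inv A \<in> SU3"
proof -
  have "conj_transpose (conj_transpose A) = A" by (simp add: vec_eq_iff)
  moreover have "A ** conj_transpose A = mat 1"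
    using assms by (simp add: SU3_def matrix_left_right_inverse)
  ultimately show ?thesis
    using assms SL3_inv(3)[of A] by (simp add: SU3_inv_eq SU3_def)
qed

section \<open>Conjugation in SL3\<close>

lemma conj_by_mult:
  assumes "g \<in> SL3"
  shows "conj_by g (A ** B) = conj_by g A ** conj_by g B"
proof -
  have "conj_by g A ** conj_by g B = g ** A ** (matrix_inv g ** g) ** B ** matrix_inv g"
    by (simp add: conj_by_def matrix_mul_assoc)
  then show ?thesis by (simp add: SL3_inv[OF assms] conj_by_def matrix_mul_assoc)
qed

lemma conj_by_comp:
  assumes "g \<in> SL3" "h \<in> SL3"
  shows "conj_by g (conj_by h A) = conj_by (g ** h) A"
  by (simp add: conj_by_def matrix_inv_mult[OF assms] matrix_mul_assoc)

lemma det_conj_by: "g \<in> SL3 \<Longrightarrow> det (conj_by g A) = det A"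
  using SL3_inv(3)[of g] by (simp add: conj_by_def det_mul SL3_def)

lemma conj_by_SL3: "g \<in> SL3 \<Longrightarrow> A \<in> SL3 \<Longrightarrow> conj_by g A \<in> SL3"
  by (simp add: SL3_def det_conj_by)

lemma conj_by_inv:
  assumes "g \<in> SL3" "A \<in> SL3"
  shows "conj_by g (matrix_inv A) = matrix_inv (conj_by g A)"
proof (rule matrix_inv_unique[symmetric])
  have "conj_by g A ** conj_by g (matrix_inv A) = conj_by g (mat 1)"
    by (simp add: SL3_inv[OF assms(2)] flip: conj_by_mult[OF assms(1)])
  then show "conj_by g A ** conj_by g (matrix_inv A) = mat 1"
    by (simp add: conj_by_def SL3_inv[OF assms(1)])
qed

lemma trace_conj_by:
  assumes "g \<in> SL3"
  shows "trace (conj_by g A) = trace A"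
proof -
  have "trace (conj_by g A) = trace (matrix_inv g ** (g ** A))"
    unfolding conj_by_def by (rule trace_mul_sym)
  then show ?thesis by (simp add: matrix_mul_assoc SL3_inv[OF assms])
qed

lemma matrix_inv_diag3:
  assumes "a * b * c = 1"
  shows "matrix_inv (diag3 a b c) = diag3 (inverse a) (inverse b) (inverse c)"
proof (rule matrix_inv_unique)
  have "a \<noteq> 0" "b \<noteq> 0" "c \<noteq> 0" using assms by auto
  then show "diag3 a b c ** diag3 (inverse a) (inverse b) (inverse c) = mat 1"
    by (simp add: cmat3_eq_iff matrix_mult_3_nth diag3_eq mat_3_nth)
qed

section \<open>Eigenvectors and diagonalization\<close>

lemma eigenvector_exists:
  fixes M :: cmat3
  assumes "det (M - mat x) = 0"
  obtains v where "v \<noteq> 0" "M *v v = x *s v"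
proof -
  have "\<not> invertible (M - mat x)" using assms by (simp add: invertible_det_nz)
  then have "\<not> (\<exists>B. B ** (M - mat x) = mat 1)"
    using matrix_left_right_inverse by (auto simp: invertible_def)
  then obtain v where v: "(M - mat x) *v v = 0" "v \<noteq> 0"
    unfolding matrix_left_invertible_ker by auto
  have "M *v v = x *s v"
    using v(1) by (simp add: vec_eq_iff matrix_vector_mult_def sum_3 forall_3 mat_def algebra_simps)
  with v(2) show ?thesis by (rule that)
qed

lemma charpoly_3:
  fixes M :: cmat3
  shows "det (M - mat x) = - (x ^ 3 - trace M * x\<^sup>2 + trace (adj3 M) * x - det M)"
  by (simp add: det_3 trace_3 adj3_def mat_def power2_eq_square power3_eq_cube algebra_simps)

text \<open>Applying M once and twice to the relation yields a Vandermonde system; eliminating v and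
  w leaves (a - b)(a - c) u = 0.\<close>

lemma eigen_combination_zero:
  fixes M :: cmat3
  assumes "M *v u = a *s u" "M *v v = b *s v" "M *v w = c *s w"
    and z: "u + v + w = 0" and d: "a \<noteq> b" "a \<noteq> c"
  shows "u = 0"
proof -
  have "M *v (u + v + w) = a *s u + b *s v + c *s w"
    by (simp add: matrix_vector_right_distrib assms(1-3))
  then have z1: "a *s u + b *s v + c *s w = 0" unfolding z by simp
  have "M *v (a *s u + b *s v + c *s w) = a *s (a *s u) + b *s (b *s v) + c *s (c *s w)"
    by (simp only: matrix_vector_right_distrib vector_scalar_commute assms(1-3))
  then have z2: "a *s (a *s u) + b *s (b *s v) + c *s (c *s w) = 0" unfolding z1 by simp
  have "u $ i = 0" for i
  proof -
    have "u $ i + v $ i + w $ i = 0" "a * u $ i + b * v $ i + c * w $ i = 0"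
      "a * (a * u $ i) + b * (b * v $ i) + c * (c * w $ i) = 0"
      using z z1 z2 by (simp_all add: vec_eq_iff mult.assoc)
    then have "(a - b) * (a - c) * u $ i = 0" by algebra
    then show ?thesis using d by simp
  qed
  then show ?thesis by (simp add: vec_eq_iff)
qed

text \<open>On \<open>SL3\<close> the traces of M and of its inverse are the coefficients of the
  characteristic polynomial, so its roots are a, b, c; being distinct, they provide an
  eigenbasis.\<close>

lemma SL3_conjugate_diag3:
  assumes M: "M \<in> SL3" and tr: "trace M = a + b + c" "trace (matrix_inv M) = a * b + b * c + c * a"
    and abc: "a * b * c = 1" and dist: "a \<noteq> b" "b \<noteq> c" "c \<noteq> a"
  shows "SL3_conjugate M (diag3 a b c)"
proof -
  have d: "det M = 1" using M by (simp add: SL3_def)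
  have "det (M - mat x) = - ((x - a) * (x - b) * (x - c))" for x
    unfolding charpoly_3 d tr matrix_inv_SL3[OF M, symmetric]
    using abc by (simp add: power2_eq_square power3_eq_cube algebra_simps)
  then have "det (M - mat a) = 0" "det (M - mat b) = 0" "det (M - mat c) = 0" by simp_all
  then obtain u v w where e: "u \<noteq> 0" "M *v u = a *s u" "v \<noteq> 0" "M *v v = b *s v" "w \<noteq> 0" "M *v w = c *s w"
    by (metis eigenvector_exists)
  define V where "V = mat3 (u $ 1) (v $ 1) (w $ 1) (u $ 2) (v $ 2) (w $ 2) (u $ 3) (v $ 3) (w $ 3)"
  have "det V \<noteq> 0"
  proof
    assume "det V = 0"
    then have "\<not> invertible V" by (simp add: invertible_det_nz)
    then have "\<not> (\<exists>B. B ** V = mat 1)"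
      using matrix_left_right_inverse by (auto simp: invertible_def)
    then obtain y where y: "V *v y = 0" "y \<noteq> 0"
      unfolding matrix_left_invertible_ker by auto
    have s: "y $ 1 *s u + y $ 2 *s v + y $ 3 *s w = 0"
      using y(1) by (simp add: V_def vec_eq_iff matrix_vector_mult_def sum_3 forall_3 mult.commute)
    have ev: "M *v (y $ 1 *s u) = a *s (y $ 1 *s u)" "M *v (y $ 2 *s v) = b *s (y $ 2 *s v)"
      "M *v (y $ 3 *s w) = c *s (y $ 3 *s w)"
      by (simp_all add: vector_scalar_commute e vector_smult_assoc mult.commute)
    have "y $ 1 *s u = 0"
      using eigen_combination_zero[OF ev s] dist by auto
    moreover have "y $ 2 *s v = 0"
      using eigen_combination_zero[OF ev(2,3,1)] s dist by (auto simp: ac_simps)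
    moreover have "y $ 3 *s w = 0"
      using eigen_combination_zero[OF ev(3,1,2)] s dist by (auto simp: ac_simps)
    ultimately have "y = 0" using e by (simp add: vec_eq_iff[of y] forall_3)
    then show False using y by simp
  qed
  \<comment> \<open>Rescaling one eigenvector brings the change of basis into
    \<open>SL3\<close>.\<close>
  define k where "k = inverse (det V)"
  define W where "W = mat3 (k * u $ 1) (v $ 1) (w $ 1) (k * u $ 2) (v $ 2) (w $ 2) (k * u $ 3) (v $ 3) (w $ 3)"
  have "det W = k * det V"
    by (simp add: W_def V_def det_3 algebra_simps)
  then have W: "W \<in> SL3" using \<open>det V \<noteq> 0\<close> by (simp add: SL3_def k_def)
  have "M ** W = W ** diag3 a b c"
  proof -
    have "\<forall>i. M $ i $ 1 * u $ 1 + M $ i $ 2 * u $ 2 + M $ i $ 3 * u $ 3 = a * u $ i"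
      "\<forall>i. M $ i $ 1 * v $ 1 + M $ i $ 2 * v $ 2 + M $ i $ 3 * v $ 3 = b * v $ i"
      "\<forall>i. M $ i $ 1 * w $ 1 + M $ i $ 2 * w $ 2 + M $ i $ 3 * w $ 3 = c * w $ i"
      using e(2,4,6) by (simp_all add: vec_eq_iff matrix_vector_mult_def sum_3)
    moreover have "x1 * (k * y1) + x2 * (k * y2) + x3 * (k * y3) = k * (x1 * y1 + x2 * y2 + x3 * y3)"
      for x1 x2 x3 y1 y2 y3 by (simp add: algebra_simps)
    ultimately show ?thesis
      unfolding cmat3_eq_iff matrix_mult_3_nth W_def diag3_eq mat3_nth by simp
  qed
  then have "conj_by (matrix_inv W) M = diag3 a b c"
    using SL3_inv[OF W] by (metis conj_by_def matrix_mul_assoc matrix_mul_lid)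
  then show ?thesis using SL3_inv(3)[OF W] by (auto simp: SL3_conjugate_def)
qed

section \<open>Unitary matrices with prescribed diagonal\<close>

lemma unit_phase:
  fixes z :: complex
  obtains v where "cmod v = 1" "z = of_real (cmod z) * v"
proof (cases "z = 0")
  case True
  then show ?thesis using that[of 1] by simp
next
  case False
  then show ?thesis using that[of "z / of_real (cmod z)"] by (simp add: norm_divide)
qed

lemma unit_cnj: "cmod v = 1 \<Longrightarrow> v * cnj v = 1"
  by (simp flip: complex_norm_square)

text \<open>Four phases have to satisfy five conditions. The first four can be solved when p is
  nonzero, and the fifth then follows from the relation between p, q and the s_i.\<close>

lemma unit_phases:
  fixes s1 s2 s3 p q :: complex
  assumes pq: "p * q = s1 * s2 * s3"
  obtains u v1 v2 v3 where "cmod u = 1" "cmod v1 = 1" "cmod v2 = 1" "cmod v3 = 1"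
    "s1 = of_real (cmod s1) * v1" "s2 = of_real (cmod s2) * (u * v2)" "s3 = of_real (cmod s3) * v3"
    "p = of_real (cmod p) * u" "q = of_real (cmod q) * (v1 * v2 * v3)"
proof -
  obtain v1 where v1: "cmod v1 = 1" "s1 = of_real (cmod s1) * v1" by (rule unit_phase)
  obtain v3 where v3: "cmod v3 = 1" "s3 = of_real (cmod s3) * v3" by (rule unit_phase)
  obtain w where w: "cmod w = 1" "s2 = of_real (cmod s2) * w" by (rule unit_phase)
  show ?thesis
  proof (cases "p = 0")
    case False
    obtain u where u: "cmod u = 1" "p = of_real (cmod p) * u" by (rule unit_phase)
    have n: "of_real (cmod p) * of_real (cmod q) = complex_of_real (cmod s1) * of_real (cmod s2) * of_real (cmod s3)"
      using arg_cong[OF pq, of cmod] by (metis norm_mult of_real_mult)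
    have "of_real (cmod p) * (u * q) = of_real (cmod p) * (of_real (cmod q) * (v1 * w * v3))"
    proof -
      have "of_real (cmod p) * (u * q) = p * q" using u(2) by (metis mult.assoc)
      also have "\<dots> = (of_real (cmod s1) * of_real (cmod s2) * of_real (cmod s3)) * (v1 * w * v3)"
        unfolding pq by (subst v1(2), subst w(2), subst v3(2)) (simp only: ac_simps)
      finally show ?thesis unfolding n[symmetric] by (simp only: ac_simps)
    qed
    then have "u * q = of_real (cmod q) * (v1 * w * v3)" using False by simp
    then have "cnj u * (u * q) = of_real (cmod q) * (v1 * (w * cnj u) * v3)" by simp
    then have "q = of_real (cmod q) * (v1 * (w * cnj u) * v3)"
      using unit_cnj[OF u(1)] by (metis mult.assoc mult.commute mult_1)
    moreover have "s2 = of_real (cmod s2) * (u * (w * cnj u))"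
      using w(2) unit_cnj[OF u(1)] by (metis mult.commute mult.left_commute mult_1_right)
    ultimately show ?thesis
      using that[of u v1 "w * cnj u" v3] u v1 v3 w by (simp add: norm_mult)
  next
    \<comment> \<open>Now u is unconstrained by p: the condition on q determines \<open>v2\<close>,
      and u is adjusted to the condition on \<open>s2\<close>.\<close>
    case True
    obtain y where y: "cmod y = 1" "q = of_real (cmod q) * y" by (rule unit_phase)
    define v2 where "v2 = y * cnj v1 * cnj v3"
    define u where "u = w * cnj v2"
    have n: "cmod v2 = 1" "cmod u = 1" by (simp_all add: v2_def u_def norm_mult v1 v3 y w)
    have "v1 * v2 * v3 = y * (v1 * cnj v1) * (v3 * cnj v3)" by (simp add: v2_def)
    then have y': "v1 * v2 * v3 = y" by (simp only: unit_cnj v1(1) v3(1) mult_1_right)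
    have "u * v2 = w * (v2 * cnj v2)" by (simp add: u_def)
    then have "u * v2 = w" by (simp only: unit_cnj n mult_1_right)
    then show ?thesis using that[of u v1 v2 v3] n v1 v3 w y True y' by simp
  qed
qed

text \<open>In a unitary matrix of determinant 1 with diagonal m1, m2, m3, the numbers g + |m_i|^2
  and g' + |m_i|^2 serve as squared moduli of the off-diagonal entries. The identities make them
  compatible with the products of entries along 2-cycles and 3-cycles.\<close>

lemma root_product:
  fixes m1 m2 m3 :: complex and g g' :: real
  assumes "g + g' = 1 - ((cmod m1)\<^sup>2 + (cmod m2)\<^sup>2 + (cmod m3)\<^sup>2)"
    and "g * g' = (cmod m1)\<^sup>2 * (cmod m2)\<^sup>2 + (cmod m2)\<^sup>2 * (cmod m3)\<^sup>2 + (cmod m3)\<^sup>2 * (cmod m1)\<^sup>2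
      - 2 * Re (m1 * m2 * m3)"
  shows "(g + (cmod m3)\<^sup>2) * (g' + (cmod m3)\<^sup>2) = (cmod (m1 * m2 - cnj m3))\<^sup>2"
    and "(g + (cmod m1)\<^sup>2) * (g + (cmod m2)\<^sup>2) * (g + (cmod m3)\<^sup>2) = (cmod (of_real g + m1 * m2 * m3))\<^sup>2"
    and "(of_real g + m1 * m2 * m3) * (of_real g' + m1 * m2 * m3)
      = (m2 * m3 - cnj m1) * (m1 * m3 - cnj m2) * (m1 * m2 - cnj m3)"
proof -
  \<comment> \<open>With the conjugates as independent variables, all claims are polynomial
    consequences of the relations s and p.\<close>
  define c1 c2 c3 where "c1 = cnj m1" and "c2 = cnj m2" and "c3 = cnj m3"
  note sq = complex_norm_square
  have s: "of_real g + of_real g' = 1 - (m1 * c1 + m2 * c2 + m3 * c3)"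
    unfolding c1_def c2_def c3_def sq[symmetric] of_real_add[symmetric] assms(1) by simp
  have "complex_of_real (2 * Re (m1 * m2 * m3)) = m1 * m2 * m3 + c1 * c2 * c3"
    unfolding complex_add_cnj[symmetric] by (simp add: c1_def c2_def c3_def)
  then have p: "of_real g * of_real g' = m1 * c1 * (m2 * c2) + m2 * c2 * (m3 * c3) + m3 * c3 * (m1 * c1)
      - (m1 * m2 * m3 + c1 * c2 * c3)"
    unfolding c1_def c2_def c3_def sq[symmetric] of_real_mult[symmetric] assms(2)
    by (simp add: sq)
  have "(of_real g + m3 * c3) * (of_real g' + m3 * c3) = (m1 * m2 - c3) * (c1 * c2 - m3)"
    using s p by algebra
  then have "complex_of_real ((g + (cmod m3)\<^sup>2) * (g' + (cmod m3)\<^sup>2)) = of_real ((cmod (m1 * m2 - cnj m3))\<^sup>2)"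
    unfolding sq of_real_mult of_real_add by (simp add: c1_def c2_def c3_def sq)
  then show "(g + (cmod m3)\<^sup>2) * (g' + (cmod m3)\<^sup>2) = (cmod (m1 * m2 - cnj m3))\<^sup>2"
    unfolding of_real_eq_iff .
  have "(of_real g + m1 * c1) * (of_real g + m2 * c2) * (of_real g + m3 * c3)
      = (of_real g + m1 * m2 * m3) * (of_real g + c1 * c2 * c3)"
    using s p by algebra
  then have "complex_of_real ((g + (cmod m1)\<^sup>2) * (g + (cmod m2)\<^sup>2) * (g + (cmod m3)\<^sup>2))
      = of_real ((cmod (of_real g + m1 * m2 * m3))\<^sup>2)"
    unfolding sq of_real_mult of_real_add by (simp add: c1_def c2_def c3_def sq)
  then show "(g + (cmod m1)\<^sup>2) * (g + (cmod m2)\<^sup>2) * (g + (cmod m3)\<^sup>2) = (cmod (of_real g + m1 * m2 * m3))\<^sup>2"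
    unfolding of_real_eq_iff .
  show "(of_real g + m1 * m2 * m3) * (of_real g' + m1 * m2 * m3)
      = (m2 * m3 - cnj m1) * (m1 * m3 - cnj m2) * (m1 * m2 - cnj m3)"
    unfolding c1_def[symmetric] c2_def[symmetric] c3_def[symmetric] using s p by algebra
qed

text \<open>The phases are chosen so that the 2-cycle products are s1, s2, s3 and the 3-cycle
  products are p, q. Then the determinant is 1, the rows are unit vectors by \<open>sum\<close>, and
  \<open>SU3_if_unit_rows\<close> applies.\<close>

lemma unitary_with_diagonal:
  fixes m1 m2 m3 :: complex and g g' :: real
  assumes sum: "g + g' = 1 - ((cmod m1)\<^sup>2 + (cmod m2)\<^sup>2 + (cmod m3)\<^sup>2)"
    and prod: "g * g' = (cmod m1)\<^sup>2 * (cmod m2)\<^sup>2 + (cmod m2)\<^sup>2 * (cmod m3)\<^sup>2 + (cmod m3)\<^sup>2 * (cmod m1)\<^sup>2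
      - 2 * Re (m1 * m2 * m3)"
    and nn: "0 \<le> g + (cmod m1)\<^sup>2" "0 \<le> g + (cmod m2)\<^sup>2" "0 \<le> g + (cmod m3)\<^sup>2"
      "0 \<le> g' + (cmod m1)\<^sup>2" "0 \<le> g' + (cmod m2)\<^sup>2" "0 \<le> g' + (cmod m3)\<^sup>2"
  obtains M where "M \<in> SU3" "M $ 1 $ 1 = m1" "M $ 2 $ 2 = m2" "M $ 3 $ 3 = m3"
    "(cmod (M $ 2 $ 1))\<^sup>2 = g + (cmod m3)\<^sup>2" "(cmod (M $ 1 $ 2))\<^sup>2 = g' + (cmod m3)\<^sup>2"
    "(cmod (M $ 3 $ 2))\<^sup>2 = g + (cmod m1)\<^sup>2" "(cmod (M $ 2 $ 3))\<^sup>2 = g' + (cmod m1)\<^sup>2"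
    "(cmod (M $ 1 $ 3))\<^sup>2 = g + (cmod m2)\<^sup>2" "(cmod (M $ 3 $ 1))\<^sup>2 = g' + (cmod m2)\<^sup>2"
proof -
  have sum': "g' + g = 1 - ((cmod m1)\<^sup>2 + (cmod m2)\<^sup>2 + (cmod m3)\<^sup>2)" using sum by simp
  have prod': "g' * g = (cmod m1)\<^sup>2 * (cmod m2)\<^sup>2 + (cmod m2)\<^sup>2 * (cmod m3)\<^sup>2 + (cmod m3)\<^sup>2 * (cmod m1)\<^sup>2
      - 2 * Re (m1 * m2 * m3)" using prod by (simp add: mult.commute)
  define s1 s2 s3 p q where "s1 = m2 * m3 - cnj m1" and "s2 = m1 * m3 - cnj m2" and "s3 = m1 * m2 - cnj m3"
    and "p = of_real g' + m1 * m2 * m3" and "q = of_real g + m1 * m2 * m3"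
  have pq: "p * q = s1 * s2 * s3"
    using root_product(3)[OF sum prod] unfolding s1_def s2_def s3_def p_def q_def by (simp only: mult.commute)
  obtain u v1 v2 v3 where v: "cmod u = 1" "cmod v1 = 1" "cmod v2 = 1" "cmod v3 = 1"
    "s1 = of_real (cmod s1) * v1" "s2 = of_real (cmod s2) * (u * v2)" "s3 = of_real (cmod s3) * v3"
    "p = of_real (cmod p) * u" "q = of_real (cmod q) * (v1 * v2 * v3)"
    by (rule unit_phases[OF pq])
  define x1 x2 x3 y1 y2 y3 where "x1 = sqrt (g + (cmod m1)\<^sup>2)" and "x2 = sqrt (g + (cmod m2)\<^sup>2)"
    and "x3 = sqrt (g + (cmod m3)\<^sup>2)" and "y1 = sqrt (g' + (cmod m1)\<^sup>2)"
    and "y2 = sqrt (g' + (cmod m2)\<^sup>2)" and "y3 = sqrt (g' + (cmod m3)\<^sup>2)"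
  note xy = x1_def x2_def x3_def y1_def y2_def y3_def
  have cs1: "cmod s1 = x1 * y1"
    unfolding xy s1_def real_sqrt_mult[symmetric]
    using root_product(1)[of g g' m2 m3 m1] sum prod by (simp add: ac_simps)
  have cs2: "cmod s2 = x2 * y2"
    unfolding xy s2_def real_sqrt_mult[symmetric]
    using root_product(1)[of g g' m1 m3 m2] sum prod by (simp add: ac_simps)
  have cs3: "cmod s3 = x3 * y3"
    unfolding xy s3_def real_sqrt_mult[symmetric] root_product(1)[OF sum prod] by simp
  have cq: "cmod q = x1 * x2 * x3"
    unfolding xy q_def real_sqrt_mult[symmetric] root_product(2)[OF sum prod] by simp
  have cp: "cmod p = y1 * y2 * y3"
    unfolding xy p_def real_sqrt_mult[symmetric] root_product(2)[OF sum' prod'] by simp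
  \<comment> \<open>The entries (1,2) and (2,3) are kept real, which a diagonal unitary conjugation
    can always achieve; the other four carry the phases.\<close>
  define M where "M = mat3 m1 (of_real y3) (of_real x2 * v2) (of_real x3 * v3) m2 (of_real y1)
    (of_real y2 * u) (of_real x1 * v1) m3"
  have entries: "M $ 1 $ 1 = m1" "M $ 2 $ 2 = m2" "M $ 3 $ 3 = m3"
    by (simp_all add: M_def)
  have norms: "(cmod (M $ 2 $ 1))\<^sup>2 = g + (cmod m3)\<^sup>2" "(cmod (M $ 1 $ 2))\<^sup>2 = g' + (cmod m3)\<^sup>2"
    "(cmod (M $ 3 $ 2))\<^sup>2 = g + (cmod m1)\<^sup>2" "(cmod (M $ 2 $ 3))\<^sup>2 = g' + (cmod m1)\<^sup>2"
    "(cmod (M $ 1 $ 3))\<^sup>2 = g + (cmod m2)\<^sup>2" "(cmod (M $ 3 $ 1))\<^sup>2 = g' + (cmod m2)\<^sup>2"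
    using nn by (simp_all add: M_def norm_mult v(1-4) xy)
  have "det M = m1 * m2 * m3 + of_real y3 * of_real y1 * (of_real y2 * u)
      + of_real x2 * v2 * (of_real x3 * v3) * (of_real x1 * v1)
      - m1 * (of_real y1 * (of_real x1 * v1)) - m2 * (of_real x2 * v2 * (of_real y2 * u))
      - m3 * (of_real y3 * (of_real x3 * v3))"
    by (simp add: M_def det_3 algebra_simps)
  also have "of_real y3 * of_real y1 * (of_real y2 * u) = p"
    by (subst v(8)) (simp add: cp)
  also have "of_real x2 * v2 * (of_real x3 * v3) * (of_real x1 * v1) = q"
    by (subst v(9)) (simp add: cq)
  also have "of_real y1 * (of_real x1 * v1) = s1" by (subst v(5)) (simp add: cs1)
  also have "of_real x2 * v2 * (of_real y2 * u) = s2" by (subst v(6)) (simp add: cs2)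
  also have "of_real y3 * (of_real x3 * v3) = s3" by (subst v(7)) (simp add: cs3)
  also have "m1 * m2 * m3 + p + q - m1 * s1 - m2 * s2 - m3 * s3
     = of_real (g + g') + (m1 * cnj m1 + m2 * cnj m2 + m3 * cnj m3)"
    unfolding p_def q_def s1_def s2_def s3_def by (simp add: algebra_simps)
  also have "\<dots> = 1"
    unfolding sum complex_norm_square[symmetric] by simp
  finally have "det M = 1" .
  moreover have "\<forall>i. (cmod (M $ i $ 1))\<^sup>2 + (cmod (M $ i $ 2))\<^sup>2 + (cmod (M $ i $ 3))\<^sup>2 = 1"
    unfolding forall_3 norms entries using sum by simp
  ultimately have "M \<in> SU3" by (intro SU3_if_unit_rows) auto
  then show ?thesis using that entries norms by blast
qed

section \<open>Diagonal conjugation into SU3\<close>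

text \<open>x and y are squared moduli of two opposite entries, r and r' the desired ones; a
  diagonal conjugation multiplies x by some k and divides y by it. If r = 0, then k has to be read
  off from y.\<close>

lemma scaling_ratio:
  fixes x y r r' :: real
  assumes "0 \<le> x" "0 \<le> y" "0 \<le> r" "0 \<le> r'" "0 < r + r'" "x * y = r * r'"
    and "r \<noteq> 0 \<Longrightarrow> x \<noteq> 0" "r' \<noteq> 0 \<Longrightarrow> y \<noteq> 0"
  obtains k where "0 < k" "x * k = r" "y = r' * k"
proof (cases "r = 0")
  case False
  then have "0 < r" "0 < x" using assms by auto
  moreover have "y = r' * (r / x)" using \<open>0 < x\<close> assms(6) by (simp add: field_simps)
  ultimately show ?thesis using that[of "r / x"] by simp
next
  case True
  then have r': "0 < r'" "0 < y" using assms by auto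
  then have "x = 0" using assms(6) True by auto
  then show ?thesis using that[of "y / r'"] r' True by simp
qed

text \<open>Each pair of opposite entries prescribes one ratio of the diagonal scalings. The three
  ratios are consistent because their product is 1, and after scaling the rows are unit
  vectors.\<close>

lemma unitarizing_diagonal:
  fixes M :: cmat3 and g g' :: real
  assumes M: "M \<in> SL3"
    and adj: "adj3 M $ 1 $ 1 = cnj (M $ 1 $ 1)" "adj3 M $ 2 $ 2 = cnj (M $ 2 $ 2)" "adj3 M $ 3 $ 3 = cnj (M $ 3 $ 3)"
    and q: "M $ 1 $ 3 * M $ 3 $ 2 * M $ 2 $ 1 = of_real g + M $ 1 $ 1 * M $ 2 $ 2 * M $ 3 $ 3"
    and p: "M $ 1 $ 2 * M $ 2 $ 3 * M $ 3 $ 1 = of_real g' + M $ 1 $ 1 * M $ 2 $ 2 * M $ 3 $ 3"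
    and nn: "\<And>i. 0 \<le> g + (cmod (M $ i $ i))\<^sup>2" "\<And>i. 0 \<le> g' + (cmod (M $ i $ i))\<^sup>2"
    and pos: "\<And>i. 0 < g + g' + 2 * (cmod (M $ i $ i))\<^sup>2"
  obtains k1 k2 k3 :: real where "k1 * k2 * k3 = 1"
    "conj_by (diag3 (of_real k1) (of_real k2) (of_real k3)) M \<in> SU3"
proof -
  define m1 m2 m3 where "m1 = M $ 1 $ 1" and "m2 = M $ 2 $ 2" and "m3 = M $ 3 $ 3"
  note m = m1_def[symmetric] m2_def[symmetric] m3_def[symmetric]
  define s1 s2 s3 where "s1 = m2 * m3 - cnj m1" and "s2 = m1 * m3 - cnj m2" and "s3 = m1 * m2 - cnj m3"
  have s: "M $ 2 $ 3 * M $ 3 $ 2 = s1" "M $ 1 $ 3 * M $ 3 $ 1 = s2" "M $ 1 $ 2 * M $ 2 $ 1 = s3"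
    using adj unfolding adj3_def mat3_nth m s1_def s2_def s3_def by (auto simp: algebra_simps)
  note q = q[unfolded m] and p = p[unfolded m]
  \<comment> \<open>Expansion over permutations: the transpositions contribute the s_i and the
    3-cycles p and q, so that det M = 1 becomes the relation for g + g'.\<close>
  have d: "det M = m1 * m2 * m3 + M $ 1 $ 2 * M $ 2 $ 3 * M $ 3 $ 1 + M $ 1 $ 3 * M $ 3 $ 2 * M $ 2 $ 1
     - m1 * (M $ 2 $ 3 * M $ 3 $ 2) - m2 * (M $ 1 $ 3 * M $ 3 $ 1) - m3 * (M $ 1 $ 2 * M $ 2 $ 1)"
    unfolding det_3 m by (simp add: algebra_simps)
  have "complex_of_real (g + g') = of_real (1 - ((cmod m1)\<^sup>2 + (cmod m2)\<^sup>2 + (cmod m3)\<^sup>2))"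
    using d M unfolding s p q of_real_diff of_real_add of_real_1 complex_norm_square
    unfolding s1_def s2_def s3_def by (simp add: SL3_def algebra_simps)
  then have sum: "g + g' = 1 - ((cmod m1)\<^sup>2 + (cmod m2)\<^sup>2 + (cmod m3)\<^sup>2)" unfolding of_real_eq_iff .
  have pq: "(of_real g + m1 * m2 * m3) * (of_real g' + m1 * m2 * m3) = s1 * s2 * s3"
    unfolding p[symmetric] q[symmetric] s[symmetric] by (simp only: ac_simps)
  have prod: "g * g' = (cmod m1)\<^sup>2 * (cmod m2)\<^sup>2 + (cmod m2)\<^sup>2 * (cmod m3)\<^sup>2 + (cmod m3)\<^sup>2 * (cmod m1)\<^sup>2
      - 2 * Re (m1 * m2 * m3)"
  proof -
    define c1 c2 c3 where "c1 = cnj m1" and "c2 = cnj m2" and "c3 = cnj m3"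
    have sc: "of_real g + of_real g' = 1 - (m1 * c1 + m2 * c2 + m3 * c3)"
      unfolding c1_def c2_def c3_def complex_norm_square[symmetric] of_real_add[symmetric] sum by simp
    have "of_real g * of_real g' = m1 * c1 * (m2 * c2) + m2 * c2 * (m3 * c3) + m3 * c3 * (m1 * c1)
        - (m1 * m2 * m3 + c1 * c2 * c3)"
      using pq sc unfolding s1_def s2_def s3_def c1_def[symmetric] c2_def[symmetric] c3_def[symmetric]
      by algebra
    also have "m1 * m2 * m3 + c1 * c2 * c3 = of_real (2 * Re (m1 * m2 * m3))"
      unfolding complex_add_cnj[symmetric] by (simp add: c1_def c2_def c3_def)
    finally have "complex_of_real (g * g') = of_real ((cmod m1)\<^sup>2 * (cmod m2)\<^sup>2 + (cmod m2)\<^sup>2 * (cmod m3)\<^sup>2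
        + (cmod m3)\<^sup>2 * (cmod m1)\<^sup>2 - 2 * Re (m1 * m2 * m3))"
      by (simp add: c1_def c2_def c3_def flip: complex_norm_square)
    then show ?thesis unfolding of_real_eq_iff .
  qed
  have sum': "g' + g = 1 - ((cmod m1)\<^sup>2 + (cmod m2)\<^sup>2 + (cmod m3)\<^sup>2)" using sum by simp
  have prod': "g' * g = (cmod m1)\<^sup>2 * (cmod m2)\<^sup>2 + (cmod m2)\<^sup>2 * (cmod m3)\<^sup>2 + (cmod m3)\<^sup>2 * (cmod m1)\<^sup>2
      - 2 * Re (m1 * m2 * m3)" using prod by (simp add: mult.commute)
  define a1 a2 a3 where "a1 = (cmod m1)\<^sup>2" and "a2 = (cmod m2)\<^sup>2" and "a3 = (cmod m3)\<^sup>2"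
  note a = a1_def[symmetric] a2_def[symmetric] a3_def[symmetric]
  note r3 = root_product(1)[OF sum prod, unfolded a]
  have r1: "(g + a1) * (g' + a1) = (cmod s1)\<^sup>2"
    using root_product(1)[of g g' m2 m3 m1] sum prod by (simp add: ac_simps s1_def a)
  have r2: "(g + a2) * (g' + a2) = (cmod s2)\<^sup>2"
    using root_product(1)[of g g' m1 m3 m2] sum prod by (simp add: ac_simps s2_def a)
  note qq = root_product(2)[OF sum prod, unfolded a, folded q]
  note pp = root_product(2)[OF sum' prod', unfolded a, folded p]
  have nn': "0 \<le> g + a1" "0 \<le> g + a2" "0 \<le> g + a3" "0 \<le> g' + a1" "0 \<le> g' + a2" "0 \<le> g' + a3"
    using nn[of 1] nn[of 2] nn[of 3] by (simp_all add: m a)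
  have pos': "0 < (g + a1) + (g' + a1)" "0 < (g + a2) + (g' + a2)" "0 < (g + a3) + (g' + a3)"
    using pos[of 1] pos[of 2] pos[of 3] by (simp_all add: m a)
  \<comment> \<open>A vanishing entry annihilates a 2-cycle product and a 3-cycle product at once;
    together they force the corresponding target modulus to be 0.\<close>
  have zero: "G + (cmod c)\<^sup>2 = 0" if "of_real G + x * y * c = 0" "x * y - cnj c = 0" for x y c :: complex and G
  proof -
    have "of_real G + cnj c * c = 0" using that by simp
    then have "complex_of_real (G + (cmod c)\<^sup>2) = 0" 
      unfolding of_real_add complex_norm_square by (simp only: mult.commute)
    then show ?thesis by (simp only: of_real_eq_0_iff)
  qed
  have nz: "g + a1 \<noteq> 0 \<Longrightarrow> M $ 3 $ 2 \<noteq> 0" "g' + a1 \<noteq> 0 \<Longrightarrow> M $ 2 $ 3 \<noteq> 0"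
    "g + a2 \<noteq> 0 \<Longrightarrow> M $ 1 $ 3 \<noteq> 0" "g' + a2 \<noteq> 0 \<Longrightarrow> M $ 3 $ 1 \<noteq> 0"
    "g + a3 \<noteq> 0 \<Longrightarrow> M $ 2 $ 1 \<noteq> 0" "g' + a3 \<noteq> 0 \<Longrightarrow> M $ 1 $ 2 \<noteq> 0"
    using zero[of g m2 m3 m1] zero[of g' m2 m3 m1] zero[of g m1 m3 m2] zero[of g' m1 m3 m2]
      zero[of g m1 m2 m3] zero[of g' m1 m2 m3] p q s
    unfolding s1_def s2_def s3_def a1_def a2_def a3_def
    by (metis mult.assoc mult.commute mult_zero_left)+
  have cs: "(cmod (M $ 3 $ 2))\<^sup>2 * (cmod (M $ 2 $ 3))\<^sup>2 = (g + a1) * (g' + a1)"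
    "(cmod (M $ 1 $ 3))\<^sup>2 * (cmod (M $ 3 $ 1))\<^sup>2 = (g + a2) * (g' + a2)"
    "(cmod (M $ 2 $ 1))\<^sup>2 * (cmod (M $ 1 $ 2))\<^sup>2 = (g + a3) * (g' + a3)"
    unfolding r1 r2 r3 s3_def[symmetric] s[symmetric] by (simp_all add: norm_mult power_mult_distrib)
  obtain k1 where k1: "0 < k1" "(cmod (M $ 3 $ 2))\<^sup>2 * k1 = g + a1" "(cmod (M $ 2 $ 3))\<^sup>2 = (g' + a1) * k1"
    using scaling_ratio[OF _ _ nn'(1) nn'(4) pos'(1) cs(1)] nz by auto
  obtain k2 where k2: "0 < k2" "(cmod (M $ 1 $ 3))\<^sup>2 * k2 = g + a2" "(cmod (M $ 3 $ 1))\<^sup>2 = (g' + a2) * k2"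
    using scaling_ratio[OF _ _ nn'(2) nn'(5) pos'(2) cs(2)] nz by auto
  obtain k3 where k3: "0 < k3" "(cmod (M $ 2 $ 1))\<^sup>2 * k3 = g + a3" "(cmod (M $ 1 $ 2))\<^sup>2 = (g' + a3) * k3"
    using scaling_ratio[OF _ _ nn'(3) nn'(6) pos'(3) cs(3)] nz by auto
  \<comment> \<open>Scaling leaves the 3-cycle products with the right moduli, so k1 k2 k3 = 1 as
    soon as one of them is nonzero. If both vanish, then g = g' and some target pair has sum
    0.\<close>
  have K: "k1 * k2 * k3 = 1"
  proof -
    define Q where "Q = (cmod (M $ 1 $ 3 * M $ 3 $ 2 * M $ 2 $ 1))\<^sup>2"
    define R where "R = (cmod (M $ 1 $ 2 * M $ 2 $ 3 * M $ 3 $ 1))\<^sup>2"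
    have "Q * (k1 * k2 * k3) = ((cmod (M $ 3 $ 2))\<^sup>2 * k1) * ((cmod (M $ 1 $ 3))\<^sup>2 * k2) * ((cmod (M $ 2 $ 1))\<^sup>2 * k3)"
      by (simp add: Q_def norm_mult power_mult_distrib)
    also have "\<dots> = Q" unfolding k1 k2 k3 qq Q_def ..
    finally have 1: "Q * (k1 * k2 * k3) = Q" .
    have "R = (cmod (M $ 2 $ 3))\<^sup>2 * (cmod (M $ 3 $ 1))\<^sup>2 * (cmod (M $ 1 $ 2))\<^sup>2"
      by (simp add: R_def norm_mult power_mult_distrib)
    also have "\<dots> = ((g' + a1) * (g' + a2) * (g' + a3)) * (k1 * k2 * k3)"
      unfolding k1 k2 k3 by (simp only: ac_simps)
    also have "\<dots> = R * (k1 * k2 * k3)" unfolding pp R_def ..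
    finally have 2: "R = R * (k1 * k2 * k3)" .
    have "Q \<noteq> 0 \<or> R \<noteq> 0"
    proof (rule ccontr)
      assume "\<not> ?thesis"
      then have z: "Q = 0" "R = 0" by auto
      then have "of_real g + m1 * m2 * m3 = 0" "of_real g' + m1 * m2 * m3 = 0"
        unfolding Q_def R_def p q by simp_all
      then have "g = g'" by (metis add_right_cancel of_real_eq_iff)
      moreover have "(g + a1) * (g + a2) * (g + a3) = 0" using z qq by (simp add: Q_def)
      ultimately show False using pos' by auto
    qed
    then show ?thesis using 1 2 by auto
  qed
  \<comment> \<open>The h_i are the squares of the scalings, with successive ratios
    \<open>k3\<close>, \<open>k1\<close>, \<open>k2\<close>; the cube root normalizes their product
    to 1.\<close>
  define h1 h2 h3 where "h1 = 1 / root 3 (k3 * (k3 * k1))" and "h2 = k3 / root 3 (k3 * (k3 * k1))"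
    and "h3 = k3 * k1 / root 3 (k3 * (k3 * k1))"
  have hr: "0 < root 3 (k3 * (k3 * k1))" "root 3 (k3 * (k3 * k1)) ^ 3 = k3 * (k3 * k1)"
    using k1(1) k3(1) by simp_all
  have hpos: "0 < h1" "0 < h2" "0 < h3" using hr k1(1) k3(1) by (simp_all add: h1_def h2_def h3_def)
  have hprod: "h1 * h2 * h3 = 1"
  proof -
    have "h1 * h2 * h3 = (k3 * (k3 * k1)) / root 3 (k3 * (k3 * k1)) ^ 3"
      by (simp add: h1_def h2_def h3_def power3_eq_cube)
    then show ?thesis unfolding hr using k1(1) k3(1) by simp
  qed
  have ratio: "h2 / h1 = k3" "h3 / h2 = k1" "h1 / h3 = k2"
    using hr(1) k1(1) k3(1) K by (simp_all add: h1_def h2_def h3_def divide_simps mult.commute mult.left_commute)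
  define U where "U = conj_by (diag3 (of_real (sqrt h1)) (of_real (sqrt h2)) (of_real (sqrt h3))) M"
  have sp: "sqrt h1 * sqrt h2 * sqrt h3 = 1" using hprod by (simp flip: real_sqrt_mult)
  then have sp': "complex_of_real (sqrt h1) * of_real (sqrt h2) * of_real (sqrt h3) = 1"
    by (metis of_real_1 of_real_mult)
  have D: "diag3 (of_real (sqrt h1)) (of_real (sqrt h2)) (of_real (sqrt h3)) \<in> SL3"
    using sp' by (simp add: SL3_def det_3 diag3_eq)
  have "det U = 1" unfolding U_def using M by (simp add: det_conj_by[OF D] SL3_def)
  moreover have "\<forall>i. (cmod (U $ i $ 1))\<^sup>2 + (cmod (U $ i $ 2))\<^sup>2 + (cmod (U $ i $ 3))\<^sup>2 = 1"
  proof -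
    have n: "(cmod (of_real (sqrt x) * z * inverse (of_real (sqrt y))))\<^sup>2 = (cmod z)\<^sup>2 * (x / y)"
      if "0 < x" "0 < y" for x y z
      using that by (simp add: norm_mult norm_divide norm_inverse power_mult_distrib power_divide divide_simps)
    have U: "(cmod (U $ 1 $ 1))\<^sup>2 = a1" "(cmod (U $ 2 $ 2))\<^sup>2 = a2" "(cmod (U $ 3 $ 3))\<^sup>2 = a3"
      "(cmod (U $ 1 $ 2))\<^sup>2 = (cmod (M $ 1 $ 2))\<^sup>2 * (h1 / h2)" "(cmod (U $ 2 $ 1))\<^sup>2 = (cmod (M $ 2 $ 1))\<^sup>2 * (h2 / h1)"
      "(cmod (U $ 2 $ 3))\<^sup>2 = (cmod (M $ 2 $ 3))\<^sup>2 * (h2 / h3)" "(cmod (U $ 3 $ 2))\<^sup>2 = (cmod (M $ 3 $ 2))\<^sup>2 * (h3 / h2)"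
      "(cmod (U $ 3 $ 1))\<^sup>2 = (cmod (M $ 3 $ 1))\<^sup>2 * (h3 / h1)" "(cmod (U $ 1 $ 3))\<^sup>2 = (cmod (M $ 1 $ 3))\<^sup>2 * (h1 / h3)"
      unfolding U_def conj_by_def matrix_inv_diag3[OF sp']
      unfolding matrix_mult_3_nth diag3_eq mat3_nth
      unfolding mult_zero_left mult_zero_right add_0_left add_0_right n[OF hpos(1) hpos(2)] n[OF hpos(2) hpos(1)]
        n[OF hpos(1) hpos(3)] n[OF hpos(3) hpos(1)] n[OF hpos(3) hpos(2)] n[OF hpos(2) hpos(3)]
        n[OF hpos(1) hpos(1)] n[OF hpos(2) hpos(2)] n[OF hpos(3) hpos(3)]
      using hpos by (simp_all add: m a)
    have inv: "h1 / h2 = 1 / k3" "h2 / h3 = 1 / k1" "h3 / h1 = 1 / k2"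
      unfolding ratio[symmetric] by simp_all
    show ?thesis
      unfolding forall_3 U inv ratio k1 k2 k3 using k1(1) k2(1) k3(1) sum by (simp add: a)
  qed
  ultimately have "U \<in> SU3" by (intro SU3_if_unit_rows) auto
  then show ?thesis using that[OF sp] unfolding U_def by blast
qed

subsection \<open>Representations over the component\<close>

lemma zeta3_facts:
  "inverse zeta3 = zeta3 * zeta3" "zeta3 * inverse zeta3 = 1" "inverse zeta3 * inverse zeta3 = zeta3"
  "zeta3 * zeta3 * zeta3 = 1" "1 + zeta3 + inverse zeta3 = 0" "cmod zeta3 = 1"
  "zeta3 ^ 3 = 1" "(inverse zeta3) ^ 3 = 1" "cnj zeta3 = inverse zeta3"
  "cnj (inverse zeta3) = zeta3" "zeta3 + 1 + inverse zeta3 = 0"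
  "zeta3 * 1 + 1 * inverse zeta3 + inverse zeta3 * zeta3 = 0"
proof -
  show i: "inverse zeta3 = zeta3 * zeta3" unfolding zeta3_inverse unfolding zeta3_eq
    by (simp add: complex_eq_iff)
  show "zeta3 * inverse zeta3 = 1" by (simp add: zeta3_def)
  then show c: "zeta3 * zeta3 * zeta3 = 1" unfolding i by (simp add: mult.assoc)
  then show "inverse zeta3 * inverse zeta3 = zeta3" unfolding i by (metis mult.assoc mult_1)
  show "1 + zeta3 + inverse zeta3 = 0" unfolding zeta3_inverse unfolding zeta3_eq
    by (simp add: complex_eq_iff)
  show "cmod zeta3 = 1" by (simp add: zeta3_eq cmod_def power_divide)
  show "zeta3 ^ 3 = 1" using c by (simp add: power3_eq_cube)
  then show "(inverse zeta3) ^ 3 = 1" by (simp add: power_inverse)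
  show "cnj zeta3 = inverse zeta3" unfolding zeta3_inverse unfolding zeta3_eq
    by (simp add: complex_eq_iff)
  then show "cnj (inverse zeta3) = zeta3" by (metis complex_cnj_cnj)
  show "zeta3 + 1 + inverse zeta3 = 0" "zeta3 * 1 + 1 * inverse zeta3 + inverse zeta3 * zeta3 = 0"
    unfolding zeta3_inverse unfolding zeta3_eq by (simp_all add: complex_eq_iff)
qed

section \<open>Traces against the diagonalized M0\<close>

abbreviation zeta_diag :: cmat3 where
  "zeta_diag \<equiv> diag3 zeta3 1 (inverse zeta3)"

lemma zeta_diag_SU3: "zeta_diag \<in> SU3"
  by (rule SU3_diag3) (simp_all add: zeta3_facts(2,6) norm_inverse)

lemma zeta_diag_inv: "matrix_inv zeta_diag = diag3 (inverse zeta3) 1 zeta3"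
  using matrix_inv_diag3[of zeta3 1 "inverse zeta3"] zeta3_facts(2) by simp

lemma trace_zeta_diag_mult:
  "trace (M ** zeta_diag) = zeta3 * M $ 1 $ 1 + M $ 2 $ 2 + inverse zeta3 * M $ 3 $ 3"
  "trace (M ** matrix_inv zeta_diag) = inverse zeta3 * M $ 1 $ 1 + M $ 2 $ 2 + zeta3 * M $ 3 $ 3"
  "trace (zeta_diag ** M) = zeta3 * M $ 1 $ 1 + M $ 2 $ 2 + inverse zeta3 * M $ 3 $ 3"
  "trace (matrix_inv zeta_diag ** M) = inverse zeta3 * M $ 1 $ 1 + M $ 2 $ 2 + zeta3 * M $ 3 $ 3"
  unfolding zeta_diag_inv by (simp_all add: trace_3 matrix_mult_3_nth diag3_eq mult.commute)

text \<open>Conjugation by \<open>zeta_diag\<close> multiplies the entries of N by cube roots of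
  unity, so the trace sorts the products of opposite entries by the cyclic difference of their
  indices.\<close>

lemma trace_commutator_zeta_diag:
  "trace (M ** zeta_diag ** N ** matrix_inv zeta_diag) =
     M $ 1 $ 1 * N $ 1 $ 1 + M $ 2 $ 2 * N $ 2 $ 2 + M $ 3 $ 3 * N $ 3 $ 3
     + zeta3 * (M $ 2 $ 1 * N $ 1 $ 2 + M $ 3 $ 2 * N $ 2 $ 3 + M $ 1 $ 3 * N $ 3 $ 1)
     + inverse zeta3 * (M $ 1 $ 2 * N $ 2 $ 1 + M $ 2 $ 3 * N $ 3 $ 2 + M $ 3 $ 1 * N $ 1 $ 3)"
proof -
  define z where "z = zeta3"
  define w where "w = inverse zeta3"
  have zw: "z * (w * a) = a" "w * (z * a) = a" "z * (z * a) = w * a" "w * (w * a) = z * a" for a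
    unfolding mult.assoc[symmetric] z_def w_def using zeta3_facts(1-3) by (simp_all add: mult.commute)
  show ?thesis
    unfolding zeta_diag_inv unfolding w_def[symmetric] unfolding z_def[symmetric]
    unfolding trace_3 matrix_mult_3_nth diag3_eq mat3_nth
    by (simp add: algebra_simps zw)
qed

text \<open>Inverse discrete Fourier transform on three points; it recovers the diagonal of a matrix
  from three traces.\<close>

lemma fourier_diagonal:
  fixes x y z a b :: complex
  assumes "x + y + z = a" "zeta3 * x + y + inverse zeta3 * z = 0" "inverse zeta3 * x + y + zeta3 * z = b"
  shows "x = (a + zeta3 * b) / 3" "y = (a + b) / 3" "z = (a + inverse zeta3 * b) / 3"
proof -
  define u w where "u = zeta3" and "w = inverse zeta3"
  have uw: "u * w = 1" "u * u = w" "w * w = u" "1 + u + w = 0" "1 + w + u = 0"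
    using zeta3_facts(1-3,5) by (simp_all add: u_def w_def add_ac)
  note * = assms[folded w_def, folded u_def]
  have "x * (1 + 2 * (u * w)) + y * (1 + u + w) + z * (1 + w * w + u * u)
      = (x + y + z) + w * (u * x + y + w * z) + u * (w * x + y + u * z)"
    by (simp add: algebra_simps)
  then have "3 * x = a + u * b" unfolding * uw by (simp add: mult.commute)
  then show "x = (a + zeta3 * b) / 3" by (simp add: u_def eq_divide_eq mult.commute)
  have "x * (1 + u + w) + 3 * y + z * (1 + u + w)
      = (x + y + z) + (u * x + y + w * z) + (w * x + y + u * z)"
    by (simp add: algebra_simps)
  then have "3 * y = a + b" unfolding * uw by simp
  then show "y = (a + b) / 3" by (simp add: eq_divide_eq mult.commute)
  have "x * (1 + u * u + w * w) + y * (1 + u + w) + z * (1 + 2 * (u * w))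
      = (x + y + z) + u * (u * x + y + w * z) + w * (w * x + y + u * z)"
    by (simp add: algebra_simps)
  then have "3 * z = a + w * b" unfolding * uw by (simp add: mult.commute)
  then show "z = (a + inverse zeta3 * b) / 3" by (simp add: w_def eq_divide_eq mult.commute)
qed

text \<open>The diagonal of \<open>M1\<close> in a basis where \<open>M0\<close> is
  \<open>zeta_diag\<close>, obtained from the traces tau, 0 and X by
  \<open>fourier_diagonal\<close>.\<close>

definition diag_entry1 :: "real \<Rightarrow> complex \<Rightarrow> complex" where
  "diag_entry1 \<tau> X = (of_real \<tau> + zeta3 * X) / 3"
definition diag_entry2 :: "real \<Rightarrow> complex \<Rightarrow> complex" where
  "diag_entry2 \<tau> X = (of_real \<tau> + X) / 3"
definition diag_entry3 :: "real \<Rightarrow> complex \<Rightarrow> complex" where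
  "diag_entry3 \<tau> X = (of_real \<tau> + inverse zeta3 * X) / 3"

text \<open>
  At \<open>y = Im Z\<close> and \<open>y = - Im Z\<close> these are the two products of off-diagonal entries of \<open>m\<close> along a
  3-cycle, each diminished by the product of the diagonal; adding the squared modulus of a diagonal entry
  yields the \<open>r i j\<close>.
\<close>

definition root_pair :: "real \<Rightarrow> complex \<Rightarrow> real \<Rightarrow> real" where
  "root_pair \<tau> X y = (1 - (\<tau>\<^sup>2 + (cmod X)\<^sup>2) / 3) / 2 + y / (3 * sqrt 3)"

text \<open>The common term is the sum of the two values of \<open>root_pair\<close> at y and -y, so
  the first three equations express the sums r i j + r j i by disk gaps. The last one is Parseval's
  identity.\<close>

lemma diagonal_norms:
  "1 - (\<tau>\<^sup>2 + (cmod X)\<^sup>2) / 3 + 2 * (cmod (diag_entry1 \<tau> X))\<^sup>2 = disk_gap \<tau> zeta3 X / 9"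
  "1 - (\<tau>\<^sup>2 + (cmod X)\<^sup>2) / 3 + 2 * (cmod (diag_entry2 \<tau> X))\<^sup>2 = disk_gap \<tau> 1 X / 9"
  "1 - (\<tau>\<^sup>2 + (cmod X)\<^sup>2) / 3 + 2 * (cmod (diag_entry3 \<tau> X))\<^sup>2 = disk_gap \<tau> (inverse zeta3) X / 9"
  "(cmod (diag_entry1 \<tau> X))\<^sup>2 + (cmod (diag_entry2 \<tau> X))\<^sup>2 + (cmod (diag_entry3 \<tau> X))\<^sup>2 = (\<tau>\<^sup>2 + (cmod X)\<^sup>2) / 3"
proof -
  have n: "(cmod ((of_real \<tau> + l * X) / 3))\<^sup>2 = (\<tau>\<^sup>2 + (cmod X)\<^sup>2 + 2 * \<tau> * Re (l * X)) / 9" if "cmod l = 1" for l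
  proof -
    have "(cmod (of_real \<tau> + l * X))\<^sup>2 = \<tau>\<^sup>2 + (cmod (l * X))\<^sup>2 + 2 * \<tau> * Re (l * X)"
      unfolding cmod_power2 by (simp add: power2_eq_square algebra_simps)
    then show ?thesis using that by (simp add: norm_divide norm_mult power_divide)
  qed
  have m: "(cmod (diag_entry1 \<tau> X))\<^sup>2 = (\<tau>\<^sup>2 + (cmod X)\<^sup>2 + 2 * \<tau> * Re (zeta3 * X)) / 9"
    "(cmod (diag_entry2 \<tau> X))\<^sup>2 = (\<tau>\<^sup>2 + (cmod X)\<^sup>2 + 2 * \<tau> * Re (1 * X)) / 9"
    "(cmod (diag_entry3 \<tau> X))\<^sup>2 = (\<tau>\<^sup>2 + (cmod X)\<^sup>2 + 2 * \<tau> * Re (inverse zeta3 * X)) / 9"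
    using n[OF zeta3_facts(6)] n[of 1] n[of "inverse zeta3"] zeta3_facts(6)
    unfolding diag_entry1_def diag_entry2_def diag_entry3_def by (simp_all add: norm_inverse)
  show "1 - (\<tau>\<^sup>2 + (cmod X)\<^sup>2) / 3 + 2 * (cmod (diag_entry1 \<tau> X))\<^sup>2 = disk_gap \<tau> zeta3 X / 9"
    "1 - (\<tau>\<^sup>2 + (cmod X)\<^sup>2) / 3 + 2 * (cmod (diag_entry2 \<tau> X))\<^sup>2 = disk_gap \<tau> 1 X / 9"
    "1 - (\<tau>\<^sup>2 + (cmod X)\<^sup>2) / 3 + 2 * (cmod (diag_entry3 \<tau> X))\<^sup>2 = disk_gap \<tau> (inverse zeta3) X / 9"
    unfolding m disk_gap_def by (simp_all add: field_simps)
  have "Re (zeta3 * X) + Re (1 * X) + Re (inverse zeta3 * X) = Re ((1 + zeta3 + inverse zeta3) * X)"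
    by (simp add: algebra_simps)
  then have "Re (zeta3 * X) + Re (1 * X) + Re (inverse zeta3 * X) = 0" unfolding zeta3_facts(5) by simp
  then have r: "Re (inverse zeta3 * X) = - Re (zeta3 * X) - Re (1 * X)" by linarith
  show "(cmod (diag_entry1 \<tau> X))\<^sup>2 + (cmod (diag_entry2 \<tau> X))\<^sup>2 + (cmod (diag_entry3 \<tau> X))\<^sup>2 = (\<tau>\<^sup>2 + (cmod X)\<^sup>2) / 3"
    unfolding m r by (simp add: field_simps)
qed

lemma root_pair_sum: "root_pair \<tau> X y + root_pair \<tau> X (- y)
    = 1 - ((cmod (diag_entry1 \<tau> X))\<^sup>2 + (cmod (diag_entry2 \<tau> X))\<^sup>2 + (cmod (diag_entry3 \<tau> X))\<^sup>2)"
  unfolding diagonal_norms(4) root_pair_def by simp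

text \<open>Here the equation of the surface enters: 4 y^2 = -\<open>disc\<close> is what gives the
  pair the product required in \<open>root_product\<close>.\<close>

lemma root_pair_prod:
  assumes "4 * y\<^sup>2 = - disc \<tau> (Re X) (Im X)"
  shows "root_pair \<tau> X y * root_pair \<tau> X (- y) = (cmod (diag_entry1 \<tau> X))\<^sup>2 * (cmod (diag_entry2 \<tau> X))\<^sup>2
     + (cmod (diag_entry2 \<tau> X))\<^sup>2 * (cmod (diag_entry3 \<tau> X))\<^sup>2 + (cmod (diag_entry3 \<tau> X))\<^sup>2 * (cmod (diag_entry1 \<tau> X))\<^sup>2
     - 2 * Re (diag_entry1 \<tau> X * diag_entry2 \<tau> X * diag_entry3 \<tau> X)"
proof -
  obtain A B where X: "X = Complex A B" by (cases X)
  define r where "r = sqrt 3"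
  have r: "r\<^sup>2 = 3" by (simp add: r_def)
  define T where "T = \<tau>\<^sup>2 + A\<^sup>2 + B\<^sup>2"
  have a: "(cmod (diag_entry1 \<tau> X))\<^sup>2 = (T - \<tau> * A - r * \<tau> * B) / 9" "(cmod (diag_entry2 \<tau> X))\<^sup>2 = (T + 2 * \<tau> * A) / 9"
    "(cmod (diag_entry3 \<tau> X))\<^sup>2 = (T - \<tau> * A + r * \<tau> * B) / 9"
    using diagonal_norms[of \<tau> X]
    by (simp_all add: disk_gap_def zeta3_eq zeta3_inverse X T_def r_def cmod_power2 field_simps)
  \<comment> \<open>The product of tau + l X over the three cube roots of unity l is tau^3 +
    X^3.\<close>
  have "27 * (diag_entry1 \<tau> X * diag_entry2 \<tau> X * diag_entry3 \<tau> X) = (of_real \<tau> + zeta3 * X) * (of_real \<tau> + X) * (of_real \<tau> + inverse zeta3 * X)"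
    by (simp add: diag_entry1_def diag_entry2_def diag_entry3_def)
  also have "\<dots> = of_real \<tau> ^ 3 + X ^ 3"
    using zeta3_facts(2,5) by algebra
  finally have "27 * Re (diag_entry1 \<tau> X * diag_entry2 \<tau> X * diag_entry3 \<tau> X) = \<tau> ^ 3 + A ^ 3 - 3 * A * B\<^sup>2"
    by (simp add: X complex_eq_iff power3_eq_cube power2_eq_square algebra_simps)
  then have d: "Re (diag_entry1 \<tau> X * diag_entry2 \<tau> X * diag_entry3 \<tau> X) = (\<tau> ^ 3 + A ^ 3 - 3 * A * B\<^sup>2) / 27" by simp
  have "root_pair \<tau> X z = (1 - T / 3) / 2 + z / (3 * r)" for z
    unfolding root_pair_def T_def r_def cmod_power2 X by (simp add: add.assoc)
  then have "root_pair \<tau> X y * root_pair \<tau> X (- y) = ((1 - T / 3) / 2 + y / (3 * r)) * ((1 - T / 3) / 2 - y / (3 * r))"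
    by simp
  also have "\<dots> = ((1 - T / 3) / 2)\<^sup>2 - (y / (3 * r))\<^sup>2"
    by (simp only: square_diff_square_factored power2_eq_square)
  also have "(y / (3 * r))\<^sup>2 = (4 * y\<^sup>2) / 108" by (simp add: power_divide power_mult_distrib r)
  also have "\<dots> = - disc \<tau> A B / 108" unfolding assms X by simp
  also have "((1 - T / 3) / 2)\<^sup>2 - - disc \<tau> A B / 108 =
     ((T - \<tau> * A)\<^sup>2 - 3 * \<tau>\<^sup>2 * B\<^sup>2) / 81 + (T + 2 * \<tau> * A) * (2 * T - 2 * \<tau> * A) / 81
     - 2 * (\<tau> ^ 3 + A ^ 3 - 3 * A * B\<^sup>2) / 27"
    unfolding disc_def T_def by (simp add: field_simps power2_eq_square power3_eq_cube)
  also have "\<dots> = ((T - \<tau> * A)\<^sup>2 - r\<^sup>2 * \<tau>\<^sup>2 * B\<^sup>2) / 81 + (T + 2 * \<tau> * A) * (2 * T - 2 * \<tau> * A) / 81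
     - 2 * (\<tau> ^ 3 + A ^ 3 - 3 * A * B\<^sup>2) / 27"
    unfolding r ..
  also have "\<dots> = (cmod (diag_entry1 \<tau> X))\<^sup>2 * (cmod (diag_entry2 \<tau> X))\<^sup>2
     + (cmod (diag_entry2 \<tau> X))\<^sup>2 * (cmod (diag_entry3 \<tau> X))\<^sup>2 + (cmod (diag_entry3 \<tau> X))\<^sup>2 * (cmod (diag_entry1 \<tau> X))\<^sup>2
     - 2 * Re (diag_entry1 \<tau> X * diag_entry2 \<tau> X * diag_entry3 \<tau> X)"
    unfolding a d by (simp add: field_simps power2_eq_square)
  finally show ?thesis .
qed

text \<open>Matches the commutator trace in \<open>trace_commutator_adj3\<close>: the real part
  fixes the sum of the pair, the imaginary part its difference.\<close>

lemma root_pair_Z: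
  assumes "Re Z = ((Re X)\<^sup>2 + (Im X)\<^sup>2 + \<tau>\<^sup>2 - 3) / 2"
  shows "Z = 3 * (zeta3 * of_real (root_pair \<tau> X (Im Z)) + inverse zeta3 * of_real (root_pair \<tau> X (- Im Z)))"
proof -
  have "sqrt 3 * sqrt 3 = (3 :: real)" by simp
  then show ?thesis
    unfolding zeta3_inverse unfolding zeta3_eq
    by (simp add: complex_eq_iff root_pair_def assms cmod_power2 field_simps)
qed

text \<open>Two reals with nonnegative sum and product are both nonnegative; the sum is a disk gap
  over 9, the product a squared modulus. Taking y as \<open>Im Z\<close> or its negative covers both
  members of the pair.\<close>

lemma root_pair_nonneg:
  assumes t: "0 < t" "t < 1 / 3" and p: "(X, Y, Z) \<in> C_u t" and y: "y\<^sup>2 = (Im Z)\<^sup>2"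
    and m: "m \<in> {diag_entry1 (tau t) X, diag_entry2 (tau t) X, diag_entry3 (tau t) X}"
  shows "0 \<le> root_pair (tau t) X y + (cmod m)\<^sup>2"
proof -
  let ?g = "root_pair (tau t) X y" and ?g' = "root_pair (tau t) X (- y)"
  have F: "4 * y\<^sup>2 = - disc (tau t) (Re X) (Im X)"
    using p unfolding C_u_iff[OF t] F_real_iff y by simp
  note sum = root_pair_sum[of "tau t" X y] and prod = root_pair_prod[OF F]
  have s: "?g + ?g' = 1 - ((tau t)\<^sup>2 + (cmod X)\<^sup>2) / 3" by (simp add: root_pair_def)
  have w: "0 \<le> disk_gap (tau t) l X" if "l ^ 3 = 1" for l
    using disk_gap_nonneg_C_u[OF t that p] by simp
  have "\<exists>l. l ^ 3 = 1 \<and> 1 - ((tau t)\<^sup>2 + (cmod X)\<^sup>2) / 3 + 2 * (cmod m)\<^sup>2 = disk_gap (tau t) l X / 9"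
    using m diagonal_norms(1-3)[of "tau t" X] zeta3_facts(7,8) power_one[of 3] by blast
  then obtain l where l: "l ^ 3 = 1" "1 - ((tau t)\<^sup>2 + (cmod X)\<^sup>2) / 3 + 2 * (cmod m)\<^sup>2 = disk_gap (tau t) l X / 9"
    by blast
  then have "0 \<le> (?g + (cmod m)\<^sup>2) + (?g' + (cmod m)\<^sup>2)"
    using w[OF l(1)] s by linarith
  moreover have "0 \<le> (?g + (cmod m)\<^sup>2) * (?g' + (cmod m)\<^sup>2)"
  proof -
    have "0 \<le> (?g + (cmod (diag_entry1 (tau t) X))\<^sup>2) * (?g' + (cmod (diag_entry1 (tau t) X))\<^sup>2)"
      using root_product(1)[of ?g ?g' "diag_entry2 (tau t) X" "diag_entry3 (tau t) X" "diag_entry1 (tau t) X"] sum prod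
      by (simp add: ac_simps)
    moreover have "0 \<le> (?g + (cmod (diag_entry2 (tau t) X))\<^sup>2) * (?g' + (cmod (diag_entry2 (tau t) X))\<^sup>2)"
      using root_product(1)[of ?g ?g' "diag_entry1 (tau t) X" "diag_entry3 (tau t) X" "diag_entry2 (tau t) X"] sum prod
      by (simp add: ac_simps)
    moreover have "0 \<le> (?g + (cmod (diag_entry3 (tau t) X))\<^sup>2) * (?g' + (cmod (diag_entry3 (tau t) X))\<^sup>2)"
      using root_product(1)[OF sum prod] by simp
    ultimately show ?thesis using m by auto
  qed
  ultimately show ?thesis by (smt (verit) mult_nonneg_nonpos2 mult_pos_neg zero_le_mult_iff)
qed

section \<open>Realization by unitary representations\<close>

lemma exp_distinct:
  assumes t: "0 < t" "t < 1 / 3"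
  defines "e \<equiv> exp (2 * of_real pi * \<i> * of_real t)" and "e' \<equiv> exp (- 2 * of_real pi * \<i> * of_real t)"
  shows "e * e' = 1" "1 + e + e' = of_real (tau t)" "1 \<noteq> e" "e \<noteq> e'" "e' \<noteq> 1"
proof -
  have e: "e = cis (2 * pi * t)" "e' = cis (- (2 * pi * t))"
    by (simp_all add: e_def e'_def cis_conv_exp mult_ac)
  show ee: "e * e' = 1" unfolding e cis_mult by simp
  show "1 + e + e' = of_real (tau t)" unfolding e by (simp add: complex_eq_iff tau_def)
  have "0 < 2 * pi * t" "2 * pi * t < pi" using t by auto
  then have "0 < sin (2 * pi * t)" by (rule sin_gt_zero)
  then show "1 \<noteq> e" "e \<noteq> e'" "e' \<noteq> 1" unfolding e by (auto simp: complex_eq_iff)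
qed

lemma zeta3_distinct: "zeta3 \<noteq> 1" "1 \<noteq> inverse zeta3" "inverse zeta3 \<noteq> zeta3"
  unfolding zeta3_inverse unfolding zeta3_eq by (simp_all add: complex_eq_iff)

lemma conj_by_id: "conj_by (mat 1) A = A"
  by (simp add: conj_by_def matrix_inv_unique)

lemma trace_diag3: "trace (diag3 a b c) = a + b + c"
  by (simp add: trace_3 diag3_eq)

lemma mat_1_SL3: "mat 1 \<in> SL3"
  by (simp add: SL3_def)

lemma trace_conj_transpose: "trace (conj_transpose A) = cnj (trace A)"
  by (simp add: trace_3)

text \<open>\<open>M0\<close> is taken as \<open>zeta_diag\<close> and \<open>M1\<close> from
  \<open>unitary_with_diagonal\<close>, and \<open>Minf\<close> is forced. For unitary matrices the
  inverse has the conjugate trace, so the traces tau and 0 determine the conjugacy classes. The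
  nodes are included.\<close>

lemma C_u_realized:
  assumes t: "0 < t" "t < 1 / 3" and p: "p \<in> C_u t"
  shows "\<exists>\<rho>. is_rep t \<rho> \<and> trace_coords \<rho> = p \<and> unitarizable \<rho>"
proof -
  obtain X Y Z where pe: "p = (X, Y, Z)" by (cases p)
  note p = p[unfolded pe]
  have F: "Y = cnj X" "Re Z = ((Re X)\<^sup>2 + (Im X)\<^sup>2 + (tau t)\<^sup>2 - 3) / 2"
    "4 * (Im Z)\<^sup>2 = - disc (tau t) (Re X) (Im X)"
    using p unfolding C_u_iff[OF t] F_real_iff by auto
  define g g' where "g = root_pair (tau t) X (Im Z)" and "g' = root_pair (tau t) X (- Im Z)"
  define n1 n2 n3 where "n1 = diag_entry1 (tau t) X" and "n2 = diag_entry2 (tau t) X" and "n3 = diag_entry3 (tau t) X"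
  note sum = root_pair_sum[of "tau t" X "Im Z", folded g_def g'_def n1_def n2_def n3_def]
  note prod = root_pair_prod[OF F(3), folded g_def g'_def n1_def n2_def n3_def]
  have nn: "0 \<le> g + (cmod n1)\<^sup>2" "0 \<le> g + (cmod n2)\<^sup>2" "0 \<le> g + (cmod n3)\<^sup>2"
      "0 \<le> g' + (cmod n1)\<^sup>2" "0 \<le> g' + (cmod n2)\<^sup>2" "0 \<le> g' + (cmod n3)\<^sup>2"
    unfolding g_def g'_def n1_def n2_def n3_def by (rule root_pair_nonneg[OF t p]; simp)+
  obtain M where M: "M \<in> SU3" and diag: "M $ 1 $ 1 = n1" "M $ 2 $ 2 = n2" "M $ 3 $ 3 = n3"
    and norms: "(cmod (M $ 2 $ 1))\<^sup>2 = g + (cmod n3)\<^sup>2" "(cmod (M $ 1 $ 2))\<^sup>2 = g' + (cmod n3)\<^sup>2"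
    "(cmod (M $ 3 $ 2))\<^sup>2 = g + (cmod n1)\<^sup>2" "(cmod (M $ 2 $ 3))\<^sup>2 = g' + (cmod n1)\<^sup>2"
    "(cmod (M $ 1 $ 3))\<^sup>2 = g + (cmod n2)\<^sup>2" "(cmod (M $ 3 $ 1))\<^sup>2 = g' + (cmod n2)\<^sup>2"
    by (rule unitary_with_diagonal[OF sum prod nn])
  have SLM: "M \<in> SL3" and LL: "zeta_diag \<in> SL3" using M zeta_diag_SU3 SU3_subset_SL3 by auto
  have MinfU: "matrix_inv (M ** zeta_diag) \<in> SU3" by (intro SU3_inv SU3_mult M zeta_diag_SU3)
  have Mi: "matrix_inv M = conj_transpose M" by (rule SU3_inv_eq[OF M])
  have four: "n1 + n2 + n3 = of_real (tau t)" "zeta3 * n1 + n2 + inverse zeta3 * n3 = 0"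
    "inverse zeta3 * n1 + n2 + zeta3 * n3 = X"
  proof -
    define u w where "u = zeta3" and "w = inverse zeta3"
    have uw: "u * w = 1" "u * u = w" "w * w = u" "1 + u + w = 0" "1 + w + u = 0"
      using zeta3_facts(1-3,5) by (simp_all add: u_def w_def add_ac)
    have "3 * n1 = of_real (tau t) + u * X" "3 * n2 = of_real (tau t) + X" "3 * n3 = of_real (tau t) + w * X"
      by (simp_all add: n1_def n2_def n3_def diag_entry1_def diag_entry2_def diag_entry3_def u_def w_def)
    note n = this
    have cancel: "a = b" if "3 * a = 3 * b" for a b :: complex using that by simp
    have "3 * (n1 + n2 + n3) = 3 * of_real (tau t) + X * (1 + u + w)"
      using n by (simp add: algebra_simps)
    then show "n1 + n2 + n3 = of_real (tau t)"
      unfolding uw mult_zero_right add_0_right by (rule cancel)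
    have "3 * (u * n1 + n2 + w * n3) = u * (3 * n1) + 3 * n2 + w * (3 * n3)" by (simp add: algebra_simps)
    also have "\<dots> = of_real (tau t) * (1 + u + w) + X * (1 + u * u + w * w)"
      unfolding n by (simp add: algebra_simps)
    also have "\<dots> = 3 * 0" unfolding uw by simp
    finally show "zeta3 * n1 + n2 + inverse zeta3 * n3 = 0"
      unfolding w_def[symmetric] unfolding u_def[symmetric] by (rule cancel)
    have "3 * (w * n1 + n2 + u * n3) = w * (3 * n1) + 3 * n2 + u * (3 * n3)" by (simp add: algebra_simps)
    also have "\<dots> = of_real (tau t) * (1 + u + w) + X * (1 + 2 * (u * w))"
      unfolding n by (simp add: algebra_simps)
    also have "\<dots> = 3 * X" unfolding uw by simp
    finally show "inverse zeta3 * n1 + n2 + zeta3 * n3 = X"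
      unfolding w_def[symmetric] unfolding u_def[symmetric] by (rule cancel)
  qed
  have tM: "trace M = of_real (tau t)" by (simp add: trace_3 diag four)
  have tMi: "trace (matrix_inv M) = of_real (tau t)"
    unfolding Mi trace_conj_transpose tM complex_cnj_complex_of_real ..
  have tML: "trace (M ** zeta_diag) = 0" by (simp add: trace_zeta_diag_mult diag four)
  let ?e = "exp (2 * of_real pi * \<i> * of_real t)" and ?e' = "exp (- 2 * of_real pi * \<i> * of_real t)"
  note e = exp_distinct[OF t]
  have "SL3_conjugate M (diag3 1 ?e ?e')"
  proof (rule SL3_conjugate_diag3[OF SLM])
    show "trace M = 1 + ?e + ?e'" unfolding tM e(2) ..
    show "trace (matrix_inv M) = 1 * ?e + ?e * ?e' + ?e' * 1"
      unfolding tMi e(1) mult_1 mult_1_right e(2)[symmetric] by (simp only: add_ac)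
    show "1 * ?e * ?e' = 1" unfolding mult_1 by (rule e(1))
  qed (rule e(3-5))+
  moreover have "SL3_conjugate zeta_diag zeta_diag"
    using mat_1_SL3 conj_by_id by (auto simp: SL3_conjugate_def)
  moreover have "SL3_conjugate (matrix_inv (M ** zeta_diag)) zeta_diag"
  proof (rule SL3_conjugate_diag3)
    show "matrix_inv (M ** zeta_diag) \<in> SL3" using MinfU SU3_subset_SL3 by auto
    show "trace (matrix_inv (M ** zeta_diag)) = zeta3 + 1 + inverse zeta3"
      unfolding SU3_inv_eq[OF SU3_mult[OF M zeta_diag_SU3]] trace_conj_transpose tML
      zeta3_facts(11) by simp
    show "trace (matrix_inv (matrix_inv (M ** zeta_diag))) = zeta3 * 1 + 1 * inverse zeta3 + inverse zeta3 * zeta3"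
      unfolding SL3_inv(4)[OF SL3_mult[OF SLM LL]] tML
      zeta3_facts(12) ..
  qed (use zeta3_facts(2) zeta3_distinct in simp_all)
  moreover have "matrix_inv (M ** zeta_diag) ** M ** zeta_diag = mat 1"
    using SL3_inv(2)[OF SL3_mult[OF SLM LL]] by (simp add: matrix_mul_assoc)
  moreover have "matrix_inv (M ** zeta_diag) \<in> SL3" using MinfU SU3_subset_SL3 by auto
  ultimately have rep: "is_rep t (zeta_diag, M, matrix_inv (M ** zeta_diag))"
    using SLM LL by (simp add: is_rep_def)
  have X: "trace (M ** matrix_inv zeta_diag) = X" unfolding trace_zeta_diag_mult diag by (rule four)
  have "trace (matrix_inv M ** zeta_diag) = cnj (trace (M ** matrix_inv zeta_diag))"
    unfolding trace_zeta_diag_mult Mi conj_transpose_nth by (simp only: complex_cnj_add complex_cnj_mult zeta3_facts(9,10) mult.commute)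
  then have Y: "trace (matrix_inv M ** zeta_diag) = Y" unfolding X F(1) .
  have "trace (M ** zeta_diag ** matrix_inv M ** matrix_inv zeta_diag) =
      of_real ((cmod n1)\<^sup>2 + (cmod n2)\<^sup>2 + (cmod n3)\<^sup>2)
      + zeta3 * of_real ((g + (cmod n3)\<^sup>2) + (g + (cmod n1)\<^sup>2) + (g + (cmod n2)\<^sup>2))
      + inverse zeta3 * of_real ((g' + (cmod n3)\<^sup>2) + (g' + (cmod n1)\<^sup>2) + (g' + (cmod n2)\<^sup>2))"
    unfolding trace_commutator_zeta_diag Mi conj_transpose_nth complex_norm_square[symmetric] diag norms
    by simp
  \<comment> \<open>The squared moduli of the diagonal cancel because the cube roots of unity sum to
    0.\<close>
  also have "\<dots> = (1 + zeta3 + inverse zeta3) * of_real ((cmod n1)\<^sup>2 + (cmod n2)\<^sup>2 + (cmod n3)\<^sup>2)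
      + 3 * (zeta3 * of_real g + inverse zeta3 * of_real g')"
    by (simp add: algebra_simps)
  also have "\<dots> = Z"
    unfolding zeta3_facts(5) using root_pair_Z[OF F(2)] by (simp add: g_def g'_def)
  finally have "trace_coords (zeta_diag, M, matrix_inv (M ** zeta_diag)) = p"
    by (simp add: trace_coords_def X Y pe)
  moreover have "unitarizable (zeta_diag, M, matrix_inv (M ** zeta_diag))"
    using M zeta_diag_SU3 MinfU mat_1_SL3 by (auto simp: unitarizable_def conj_by_id intro!: bexI[of _ "mat 1"])
  ultimately show ?thesis using rep by blast
qed

section \<open>Unitarizability of the irreducible representations\<close>

text \<open>The 2-cycle terms occur with all three cube roots of unity and cancel; only the 3-cycle
  products and the product of the diagonal remain.\<close>

lemma trace_commutator_adj3:
  "trace (M ** zeta_diag ** adj3 M ** matrix_inv zeta_diag) =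
    3 * (zeta3 * (M $ 1 $ 3 * M $ 3 $ 2 * M $ 2 $ 1 - M $ 1 $ 1 * M $ 2 $ 2 * M $ 3 $ 3)
       + inverse zeta3 * (M $ 1 $ 2 * M $ 2 $ 3 * M $ 3 $ 1 - M $ 1 $ 1 * M $ 2 $ 2 * M $ 3 $ 3))"
proof -
  have w: "inverse zeta3 = - 1 - zeta3" using zeta3_facts(5) by algebra
  show ?thesis
    unfolding trace_commutator_zeta_diag unfolding w adj3_def mat3_nth by (simp add: algebra_simps)
qed

text \<open>Once \<open>M0\<close> is diagonal, the trace coordinates determine the diagonal and
  both 3-cycle products of M. The final conjugation is by a diagonal matrix, hence fixes
  \<open>zeta_diag\<close>, so \<open>M0\<close> and \<open>M1\<close> become unitary
  simultaneously.\<close>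

lemma C_u_unitarizable:
  assumes t: "0 < t" "t < 1 / 3" and rep: "is_rep t \<rho>" and \<rho>: "trace_coords \<rho> \<in> C_u t \<inter> F_star t"
  shows "unitarizable \<rho>"
proof -
  obtain M0 M1 Minf where r: "\<rho> = (M0, M1, Minf)" by (cases \<rho>)
  let ?e = "exp (2 * of_real pi * \<i> * of_real t)" and ?e' = "exp (- 2 * of_real pi * \<i> * of_real t)"
  note e = exp_distinct[OF t]
  have S: "M0 \<in> SL3" "M1 \<in> SL3" "Minf \<in> SL3" and prod1: "Minf ** M1 ** M0 = mat 1"
    and c1: "SL3_conjugate M1 (diag3 1 ?e ?e')" and c0: "SL3_conjugate M0 zeta_diag"
    and ci: "SL3_conjugate Minf zeta_diag"
    using rep unfolding is_rep_def r by auto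
  obtain X Y Z where XYZ: "trace_coords \<rho> = (X, Y, Z)" by (cases "trace_coords \<rho>")
  have co: "(X, Y, Z) \<in> C_u_star t" using \<rho> unfolding C_u_star_eq[OF t] XYZ .
  then have Cu: "(X, Y, Z) \<in> C_u t" unfolding C_u_star_eq[OF t] by simp
  have F: "Y = cnj X" "Re Z = ((Re X)\<^sup>2 + (Im X)\<^sup>2 + (tau t)\<^sup>2 - 3) / 2"
    using Cu unfolding C_u_iff[OF t] F_real_iff by auto
  obtain h where h: "h \<in> SL3" "conj_by h M0 = zeta_diag" using c0 by (auto simp: SL3_conjugate_def)
  have tr_conj: "trace A = trace D \<and> trace (matrix_inv A) = trace (matrix_inv D)"
    if "SL3_conjugate A D" "A \<in> SL3" for A D
    using that trace_conj_by conj_by_inv unfolding SL3_conjugate_def by metis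
  define M where "M = conj_by h M1"
  have M: "M \<in> SL3" unfolding M_def by (rule conj_by_SL3[OF h(1) S(2)])
  have LL: "zeta_diag \<in> SL3" using zeta_diag_SU3 SU3_subset_SL3 by auto
  have Minf: "matrix_inv (M1 ** M0) = Minf"
    using matrix_inv_unique[of Minf "M1 ** M0"] prod1 SL3_inv(4)[OF S(3)] by (simp add: matrix_mul_assoc)
  have Minf': "matrix_inv Minf = M1 ** M0"
    unfolding Minf[symmetric] by (rule SL3_inv(4)[OF SL3_mult[OF S(2,1)]])
  have tD: "trace zeta_diag = 0" "trace (matrix_inv zeta_diag) = 0"
    unfolding zeta_diag_inv trace_diag3 using zeta3_facts(11) by (simp_all only: add_ac)
  have iD: "matrix_inv (diag3 1 ?e ?e') = diag3 (inverse 1) (inverse ?e) (inverse ?e')"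
    by (rule matrix_inv_diag3) (simp only: mult_1 e(1))
  have ie: "inverse ?e = ?e'" "inverse ?e' = ?e"
    using e(1) by (metis inverse_unique mult.commute)+
  have tM: "trace M = of_real (tau t)" "trace (matrix_inv M) = of_real (tau t)"
    unfolding M_def conj_by_inv[OF h(1) S(2), symmetric] trace_conj_by[OF h(1)]
    using tr_conj[OF c1 S(2)] unfolding iD ie trace_diag3 e(2)[symmetric] by (simp_all only: inverse_1 add_ac)
  have SLM: "conj_by h (M1 ** M0) = M ** zeta_diag"
    unfolding M_def conj_by_mult[OF h(1)] h(2) ..
  \<comment> \<open>The product of \<open>M1\<close> and \<open>M0\<close> is the inverse of
    \<open>Minf\<close>, whose eigenvalues are the three cube roots of unity.\<close>
  have t1: "trace (M ** zeta_diag) = 0" "trace (matrix_inv zeta_diag ** matrix_inv M) = 0"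
    unfolding matrix_inv_mult[OF M LL, symmetric] SLM[symmetric]
      conj_by_inv[OF h(1) SL3_mult[OF S(2,1)], symmetric] trace_conj_by[OF h(1)] Minf
    unfolding Minf'[symmetric] using tr_conj[OF ci S(3)] tD by simp_all
  have i0: "conj_by h (matrix_inv M0) = matrix_inv zeta_diag" "conj_by h (matrix_inv M1) = matrix_inv M"
    unfolding conj_by_inv[OF h(1) S(1)] conj_by_inv[OF h(1) S(2)] h(2) M_def by simp_all
  have c: "M ** matrix_inv zeta_diag = conj_by h (M1 ** matrix_inv M0)"
    "matrix_inv M ** zeta_diag = conj_by h (matrix_inv M1 ** M0)"
    "M ** zeta_diag ** matrix_inv M ** matrix_inv zeta_diag = conj_by h (M1 ** M0 ** matrix_inv M1 ** matrix_inv M0)"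
    by (simp_all only: conj_by_mult[OF h(1)] i0 h(2) M_def[symmetric])
  have tc: "trace (M ** matrix_inv zeta_diag) = X" "trace (matrix_inv M ** zeta_diag) = Y"
    "trace (M ** zeta_diag ** matrix_inv M ** matrix_inv zeta_diag) = Z"
    using XYZ unfolding c trace_conj_by[OF h(1)] r trace_coords_def by simp_all
  define N where "N = adj3 M"
  have N: "matrix_inv M = N" unfolding N_def by (rule matrix_inv_SL3[OF M])
  note tM = tM[unfolded N trace_3] and t1 = t1[unfolded N trace_zeta_diag_mult] and tc = tc[unfolded N]
  note tc1 = tc(1,2)[unfolded trace_zeta_diag_mult]
  have diag: "M $ 1 $ 1 = diag_entry1 (tau t) X" "M $ 2 $ 2 = diag_entry2 (tau t) X" "M $ 3 $ 3 = diag_entry3 (tau t) X"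
    unfolding diag_entry1_def diag_entry2_def diag_entry3_def by (rule fourier_diagonal[OF tM(1) t1(1) tc1(1)])+
  \<comment> \<open>For the inverse matrix \<open>zeta3\<close> and its inverse exchange roles in
    the traces, so the Fourier inversion is applied with the indices reversed.\<close>
  have "N $ 3 $ 3 = (of_real (tau t) + zeta3 * Y) / 3" "N $ 2 $ 2 = (of_real (tau t) + Y) / 3"
    "N $ 1 $ 1 = (of_real (tau t) + inverse zeta3 * Y) / 3"
    by (rule fourier_diagonal[of "N $ 3 $ 3" "N $ 2 $ 2" "N $ 1 $ 1"];
        use tM(2) t1(2) tc1(2) in \<open>simp add: algebra_simps\<close>)+
  then have diagN: "N $ 1 $ 1 = cnj (M $ 1 $ 1)" "N $ 2 $ 2 = cnj (M $ 2 $ 2)" "N $ 3 $ 3 = cnj (M $ 3 $ 3)"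
    unfolding diag diag_entry1_def diag_entry2_def diag_entry3_def F(1) by (simp_all add: zeta3_facts(9))
  define d p q where "d = M $ 1 $ 1 * M $ 2 $ 2 * M $ 3 $ 3"
    and "p = M $ 1 $ 2 * M $ 2 $ 3 * M $ 3 $ 1" and "q = M $ 1 $ 3 * M $ 3 $ 2 * M $ 2 $ 1"
  have Zpq: "3 * (zeta3 * (q - d) + inverse zeta3 * (p - d)) = Z"
    using tc(3) unfolding N_def trace_commutator_adj3 d_def p_def q_def .
  define g g' where "g = root_pair (tau t) X (Im Z)" and "g' = root_pair (tau t) X (- Im Z)"
  have Zg: "3 * (zeta3 * of_real g + inverse zeta3 * of_real g') = Z"
    unfolding g_def g'_def by (rule root_pair_Z[OF F(2), symmetric])
  have "3 * (zeta3 * (q - d - of_real g) + inverse zeta3 * (p - d - of_real g'))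
      = 3 * (zeta3 * (q - d) + inverse zeta3 * (p - d)) - 3 * (zeta3 * of_real g + inverse zeta3 * of_real g')"
    by (simp add: algebra_simps)
  then have lin1: "zeta3 * (q - d - of_real g) + inverse zeta3 * (p - d - of_real g') = 0"
    unfolding Zpq Zg diff_self mult_eq_0_iff by simp
  have lin2: "(q - d - of_real g) + (p - d - of_real g') = 0"
  proof -
    have "1 = det M" using M by (simp add: SL3_def)
    also have "\<dots> = (q - d) + (p - d) + (M $ 1 $ 1 * N $ 1 $ 1 + M $ 2 $ 2 * N $ 2 $ 2 + M $ 3 $ 3 * N $ 3 $ 3)"
      unfolding N_def adj3_def mat3_nth det_3 d_def p_def q_def by (simp add: algebra_simps)
    also have "M $ 1 $ 1 * N $ 1 $ 1 + M $ 2 $ 2 * N $ 2 $ 2 + M $ 3 $ 3 * N $ 3 $ 3 = of_real (1 - (g + g'))"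
      unfolding diagN complex_norm_square[symmetric] diag g_def g'_def root_pair_sum by simp
    finally show ?thesis by (simp add: algebra_simps)
  qed
  \<comment> \<open>The commutator trace and the determinant give two homogeneous linear equations
    for the deviations of q and p from their expected values; the system is regular as
    \<open>zeta3\<close> differs from its inverse.\<close>
  have "(zeta3 - inverse zeta3) * (q - d - of_real g) = 0" using lin1 lin2 by algebra
  then have "q - d - of_real g = 0" using zeta3_distinct(3) unfolding mult_eq_0_iff by simp
  then have qg: "q = of_real g + d" by (simp add: algebra_simps)
  then have pg: "p = of_real g' + d" using lin2 by (simp add: algebra_simps)
  have nn: "0 \<le> g + (cmod (M $ i $ i))\<^sup>2 \<and> 0 \<le> g' + (cmod (M $ i $ i))\<^sup>2" for i
  proof -
    have "M $ i $ i \<in> {diag_entry1 (tau t) X, diag_entry2 (tau t) X, diag_entry3 (tau t) X}"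
      using exhaust_3[of i] diag by auto
    then show ?thesis
      using root_pair_nonneg[OF t Cu, of "Im Z" "M $ i $ i"] root_pair_nonneg[OF t Cu, of "- Im Z" "M $ i $ i"]
      by (simp add: g_def g'_def)
  qed
  have pos: "0 < g + g' + 2 * (cmod (M $ i $ i))\<^sup>2" for i
  proof -
    have s: "g + g' = 1 - ((tau t)\<^sup>2 + (cmod X)\<^sup>2) / 3" by (simp add: g_def g'_def root_pair_def)
    have w: "0 < disk_gap (tau t) l X" if "l ^ 3 = 1" for l
      using disk_gap_pos_C_u_star[OF t that co] by simp
    have "\<exists>l. l ^ 3 = 1 \<and> 1 - ((tau t)\<^sup>2 + (cmod X)\<^sup>2) / 3 + 2 * (cmod (M $ i $ i))\<^sup>2 = disk_gap (tau t) l X / 9"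
      using exhaust_3[of i] diag diagonal_norms(1-3)[of "tau t" X] zeta3_facts(7,8) power_one[of 3] by metis
    then obtain l where l: "l ^ 3 = 1" "1 - ((tau t)\<^sup>2 + (cmod X)\<^sup>2) / 3 + 2 * (cmod (M $ i $ i))\<^sup>2 = disk_gap (tau t) l X / 9"
      by blast
    show ?thesis using w[OF l(1)] l(2) s by linarith
  qed
  obtain k1 k2 k3 :: real where k: "k1 * k2 * k3 = 1"
    "conj_by (diag3 (of_real k1) (of_real k2) (of_real k3)) M \<in> SU3"
    using unitarizing_diagonal[OF M diagN[unfolded N_def] qg[unfolded q_def d_def] pg[unfolded p_def d_def]]
      nn pos by blast
  define K where "K = diag3 (of_real k1) (of_real k2) (of_real k3)"
  have k': "complex_of_real k1 * of_real k2 * of_real k3 = 1"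
    using k(1) by (metis of_real_1 of_real_mult)
  then have KL: "K \<in> SL3" by (simp add: SL3_def K_def det_3 diag3_eq)
  have "k1 \<noteq> 0" "k2 \<noteq> 0" "k3 \<noteq> 0" using k(1) by auto
  then have KLam: "conj_by K zeta_diag = zeta_diag"
    unfolding K_def conj_by_def matrix_inv_diag3[OF k']
    by (simp add: cmat3_eq_iff matrix_mult_3_nth diag3_eq)
  define G where "G = K ** h"
  have G: "G \<in> SL3" unfolding G_def by (rule SL3_mult[OF KL h(1)])
  have G0: "conj_by G M0 \<in> SU3"
    unfolding G_def conj_by_comp[OF KL h(1), symmetric] h(2) KLam by (rule zeta_diag_SU3)
  have G1: "conj_by G M1 \<in> SU3"
    unfolding G_def conj_by_comp[OF KL h(1), symmetric] M_def[symmetric] using k(2) by (simp add: K_def)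
  have "conj_by G Minf \<in> SU3"
    unfolding Minf[symmetric] conj_by_inv[OF G SL3_mult[OF S(2,1)]] conj_by_mult[OF G]
    by (intro SU3_inv SU3_mult G0 G1)
  then show ?thesis using G G0 G1 unfolding r unitarizable_def by blast
qed

theorem theorem7:
  fixes t :: real
  assumes "0 < t" and "t < 1 / 3"
  shows "C_u t \<subseteq> F_real t \<and> C_u t \<in> closed_components t \<and>
    (\<forall>p \<in> C_u t. \<exists>\<rho>. is_rep t \<rho> \<and> trace_coords \<rho> = p \<and> unitarizable \<rho>) \<and>
    (\<forall>\<rho>. is_rep t \<rho> \<and> trace_coords \<rho> \<in> C_u t \<inter> F_star t \<longrightarrow> unitarizable \<rho>)"
proof (intro conjI)
  show "C_u t \<subseteq> F_real t" unfolding C_u_eq[OF assms] by blast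
  show "C_u t \<in> closed_components t" by (rule C_u_closed_component[OF assms])
  show "\<forall>p \<in> C_u t. \<exists>\<rho>. is_rep t \<rho> \<and> trace_coords \<rho> = p \<and> unitarizable \<rho>"
    using C_u_realized[OF assms] by blast
  show "\<forall>\<rho>. is_rep t \<rho> \<and> trace_coords \<rho> \<in> C_u t \<inter> F_star t \<longrightarrow> unitarizable \<rho>"
    using C_u_unitarizable[OF assms] by blast
qed

end
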